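(* Let $$L=\Bigl\{s\in\mathbb{C}:\ |s|>2\pi e^2,\ -\tfrac{\pi}{2}+2\varphi\bigl(\sqrt{|s|/2\pi}\bigr)<\arg s<\tfrac{\pi}{2}\Bigr\},$$ where $\varphi$ is the function defined in the context. There is a certain $r_0>0$ such that for all $s=\sigma+it\in L$ with $\sigma\ge2$ and $|s|\ge r_0$ we have $$|\mathcal{R}(s)-1|\le\frac34.$$ In particular, $\mathcal{R}(s)$ does not vanish on this set.
   Context: Riemann's auxiliary function is the entire function $$\mathcal{R}(s)=\int_{0\swarrow1}\frac{x^{-s}e^{\pi i x^2}}{e^{\pi i x}-e^{-\pi i x}}\,dx,$$ where the path is a straight line of direction $e^{-3\pi i/4}$ (running from the upper right to the lower left) crossing the real axis at a point strictly between $0$ and $1$, and $x^{-s}=\exp(-s\log x)$ with the principal logarithm. The function $\varphi:[e,+\infty)\to[0,\pi/4]$ is the (unique) function such that $$\{\xi\in\mathbb{C}:|\xi|\ge e,\ |\xi^{-2\pi i\xi^2}e^{\pi i\xi^2+\pi\xi}|\le1,\ -\tfrac{\pi}{2}\le\arg\xi\le-\tfrac{\pi}{4}\}=\{\xi\in\mathbb{C}:|\xi|\ge e,\ -\tfrac{\pi}{2}+\varphi(|\xi|)\le\arg\xi\le-\tfrac{\pi}{4}\},$$ where $\xi^z=\exp(z\log\xi)$ with $\log\xi=\log|\xi|+i\arg\xi$, $-\pi/2\le\arg\xi\le0$. $\arg s$ is the principal argument. *)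

theory Defs
  imports
    "HOL-Complex_Analysis.Complex_Analysis"
    "HOL-Probability.Probability"
    "HOL-Real_Asymp.Real_Asymp"
begin

definition R_integrand :: "complex \<Rightarrow> complex \<Rightarrow> complex" where
  "R_integrand s x = x powr (- s) * exp (pi * \<i> * x\<^sup>2)
                       / (exp (pi * \<i> * x) - exp (- (pi * \<i> * x)))"

definition R_dir :: complex where
  "R_dir = exp (- (3 * pi / 4) * \<i>)"

text \<open>The integrand pulled back along \<open>x = c + u * R_dir\<close>, including the factor \<open>dx / du = R_dir\<close>.
  As \<open>u\<close> runs from minus to plus infinity, \<open>x\<close> runs from the upper right to the lower left.\<close>

definition R_line_integrand :: "real \<Rightarrow> complex \<Rightarrow> real \<Rightarrow> complex" where
  "R_line_integrand c s u = R_integrand s (c + u * R_dir) * R_dir"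

text \<open>The crossing point may be any \<open>c\<close> with \<open>0 < c < 1\<close>. The definition takes \<open>c = 1/2\<close>; by
  \<open>Riemann_R_eq\<close> below, the integral converges absolutely and has the same value for every such \<open>c\<close>.\<close>

definition Riemann_R :: "complex \<Rightarrow> complex" where
  "Riemann_R s = (LBINT u. R_line_integrand (1/2) s u)"

text \<open>Since \<open>-pi/2 \<le> Arg \<xi> \<le> -pi/4\<close> on both sides, the branch of \<open>log \<xi>\<close> with argument in
  \<open>[-pi/2, 0]\<close> is the principal one used by \<open>powr\<close>.\<close>

definition phi_property :: "(real \<Rightarrow> real) \<Rightarrow> bool" where
  "phi_property f \<longleftrightarrow>
     {\<xi>::complex. norm \<xi> \<ge> exp 1 \<and>
        norm (\<xi> powr (- 2 * pi * \<i> * \<xi>\<^sup>2) * exp (pi * \<i> * \<xi>\<^sup>2 + pi * \<xi>)) \<le> 1 \<and>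
        - (pi / 2) \<le> Arg \<xi> \<and> Arg \<xi> \<le> - (pi / 4)}
   = {\<xi>::complex. norm \<xi> \<ge> exp 1 \<and>
        - (pi / 2) + f (norm \<xi>) \<le> Arg \<xi> \<and> Arg \<xi> \<le> - (pi / 4)}"

text \<open>The extensional function space makes the function unique (\<open>phi_ex1\<close> below) by fixing its
  values to \<open>undefined\<close> outside \<open>[e, \<infinity>)\<close>.\<close>

definition phi :: "real \<Rightarrow> real" where
  "phi = (THE f. f \<in> {exp 1..} \<rightarrow>\<^sub>E {0..pi / 4} \<and> phi_property f)"

definition region_L :: "complex set" where
  "region_L = {s. norm s > 2 * pi * (exp 1)\<^sup>2 \<and>
                  - (pi / 2) + 2 * phi (sqrt (norm s / (2 * pi))) < Arg s \<and> Arg s < pi / 2}"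


subsection \<open>Independence of the crossing point\<close>

lemma R_dir_simps: "Re R_dir = - (sqrt 2 / 2)" "Im R_dir = - (sqrt 2 / 2)" "norm R_dir = 1"
proof -
  have q: "3 * pi / 4 = pi - pi / 4" by simp
  have t: "cos (3 * pi / 4) = - (sqrt 2 / 2)" "sin (3 * pi / 4) = sqrt 2 / 2"
    unfolding q by (simp_all only: cos_pi_minus sin_pi_minus cos_45 sin_45)
  have e: "R_dir = cis (- (3 * pi / 4))" by (simp add: R_dir_def cis_conv_exp mult_ac)
  show "Re R_dir = - (sqrt 2 / 2)" "Im R_dir = - (sqrt 2 / 2)" "norm R_dir = 1"
    unfolding e by (simp_all add: t)
qed

definition R_strip :: "complex set" where
  "R_strip = {x. 0 < Re x - Im x \<and> Re x - Im x < 1}"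

lemma R_line_in_strip: "0 < c \<Longrightarrow> c < 1 \<Longrightarrow> complex_of_real c + of_real u * R_dir \<in> R_strip"
  by (simp add: R_strip_def R_dir_simps)

lemma convex_R_strip: "convex R_strip" and open_R_strip: "open R_strip"
proof -
  have e: "R_strip = {x. inner (Complex 1 (-1)) x > 0} \<inter> {x. inner (Complex 1 (-1)) x < 1}"
    by (auto simp: R_strip_def inner_complex_def)
  show "convex R_strip" "open R_strip" unfolding e
    by (intro convex_Int open_Int convex_halfspace_gt convex_halfspace_lt open_halfspace_gt open_halfspace_lt)+
qed

lemma R_strip_denom:
  assumes "x \<in> R_strip" shows "exp (pi * \<i> * x) - exp (- (pi * \<i> * x)) \<noteq> 0"
proof
  assume "exp (pi * \<i> * x) - exp (- (pi * \<i> * x)) = 0"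
  hence "exp (pi * \<i> * x) = exp (- (pi * \<i> * x))" by simp
  then obtain n :: int where n: "pi * \<i> * x = - (pi * \<i> * x) + (of_int (2 * n) * pi) * \<i>"
    unfolding exp_eq by auto
  hence "2 * pi * \<i> * (x - of_int n) = 0" by (simp add: algebra_simps)
  hence x: "x = of_int n" by simp
  have "0 < n \<and> n < 1" using assms by (simp add: x R_strip_def)
  thus False by linarith
qed

lemma R_integrand_holomorphic: "R_integrand s holomorphic_on R_strip"
proof -
  have "x \<notin> \<real>\<^sub>\<le>\<^sub>0" if "x \<in> R_strip" for x
    using that by (auto simp: R_strip_def complex_nonpos_Reals_iff)
  thus ?thesis unfolding R_integrand_def
    by (intro holomorphic_intros) (use R_strip_denom in auto)
qed

lemma R_line_integrand_continuous:
  assumes "0 < c" "c < 1" shows "continuous_on UNIV (R_line_integrand c s)"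
proof -
  have "continuous_on UNIV (R_integrand s \<circ> (\<lambda>u. complex_of_real c + of_real u * R_dir))"
    using R_line_in_strip[OF assms]
    by (intro continuous_on_compose continuous_intros
          continuous_on_subset[OF holomorphic_on_imp_continuous_on[OF R_integrand_holomorphic]]) auto
  thus ?thesis unfolding R_line_integrand_def by (intro continuous_intros) (simp add: o_def)
qed

lemma R_integrand_bound:
  obtains A where "\<And>c v. 0 \<le> c \<Longrightarrow> c \<le> 1 \<Longrightarrow> \<bar>v\<bar> \<ge> 1 \<Longrightarrow>
    norm (R_integrand s (complex_of_real c + of_real v * R_dir)) \<le> A * exp (- v\<^sup>2)"
proof
  fix c v :: real
  assume c: "0 \<le> c" "c \<le> 1" and v: "\<bar>v\<bar> \<ge> 1"
  define S where "S = norm s"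
  define B where "B = S + 2 * pi"
  define k :: real where "k = sqrt 2 / 2"
  define x where "x = complex_of_real c + of_real v * R_dir"
  have kk: "2 * k * k = 1" by (simp add: k_def)
  have k: "k \<ge> 1 / 2" "k \<le> 1" using sqrt2_less_2 by (simp_all add: k_def)
  have x: "Re x = c - v * k" "Im x = - (v * k)" by (simp_all add: x_def R_dir_simps k_def)
  have "norm x \<le> norm (complex_of_real c) + norm (of_real v * R_dir)"
    unfolding x_def by (rule norm_triangle_ineq)
  hence xu: "norm x \<le> 1 + \<bar>v\<bar>" using c by (simp add: norm_mult R_dir_simps)
  have vk: "\<bar>v * k\<bar> \<ge> 1 / 2" using mult_mono[of 1 "\<bar>v\<bar>" "1/2" k] v k by (simp add: abs_mult)
  hence xl: "norm x \<ge> 1 / 2" using abs_Im_le_cmod[of x] x by simp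
  hence x0: "x \<noteq> 0" by auto
  have "ln (norm x) \<le> \<bar>v\<bar>" using ln_le_minus_one[of "norm x"] xu xl by linarith
  moreover have "- ln (norm x) \<le> 1"
  proof -
    have "- ln (norm x) = ln (1 / norm x)" using x0 by (simp add: ln_div)
    also have "\<dots> \<le> 1 / norm x - 1" using x0 by (intro ln_le_minus_one) auto
    also have "1 / norm x \<le> 2" using xl x0 by (simp add: field_simps)
    finally show ?thesis by simp
  qed
  ultimately have "\<bar>ln (norm x)\<bar> \<le> \<bar>v\<bar> + 1" by linarith
  moreover have "\<bar>Im (Ln x)\<bar> \<le> pi" using mpi_less_Im_Ln[OF x0] Im_Ln_le_pi[OF x0] by linarith
  ultimately have "norm (Ln x) \<le> \<bar>v\<bar> + 1 + pi"
    using cmod_le[of "Ln x"] x0 by (simp add: Re_Ln)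
  hence "norm s * norm (Ln x) \<le> S * (\<bar>v\<bar> + 1 + pi)" unfolding S_def by (intro mult_left_mono) auto
  moreover have "Re (- s * Ln x) \<le> norm s * norm (Ln x)"
    using complex_Re_le_cmod[of "- s * Ln x"] by (simp add: norm_mult)
  ultimately have 1: "norm (x powr (- s)) \<le> exp (S * (\<bar>v\<bar> + 1 + pi))"
    using x0 by (simp add: powr_def)
  have "2 * (v * k) * c \<le> 2 * \<bar>v\<bar>"
  proof -
    have "\<bar>v\<bar> * (k * c) \<le> \<bar>v\<bar> * 1" using c k by (intro mult_left_mono mult_le_one) auto
    moreover have "v * (k * c) \<le> \<bar>v\<bar> * (k * c)" using c k by (intro mult_right_mono) auto
    ultimately have "v * (k * c) \<le> \<bar>v\<bar>" by linarith
    thus ?thesis by (simp add: mult.assoc)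
  qed
  moreover have "Im (x\<^sup>2) = v\<^sup>2 * (2 * k * k) - 2 * (v * k) * c"
    by (simp add: power2_eq_square x algebra_simps)
  ultimately have "Im (x\<^sup>2) \<ge> v\<^sup>2 - 2 * \<bar>v\<bar>" using kk by simp
  hence "pi * (v\<^sup>2 - 2 * \<bar>v\<bar>) \<le> pi * Im (x\<^sup>2)" by (intro mult_left_mono) auto
  hence 2: "norm (exp (pi * \<i> * x\<^sup>2)) \<le> exp (2 * pi * \<bar>v\<bar> - pi * v\<^sup>2)"
    by (simp add: algebra_simps del: Im_power2)
  define y where "y = pi * (v * k)"
  have "pi * \<bar>v * k\<bar> \<ge> 2 * (1 / 2)" using vk pi_gt3 by (intro mult_mono) auto
  hence y: "\<bar>y\<bar> \<ge> 1" by (simp add: y_def abs_mult)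
  have n1: "norm (exp (pi * \<i> * x)) = exp y" "norm (exp (- (pi * \<i> * x))) = exp (- y)"
    by (simp_all add: x y_def)
  have "\<bar>exp y - exp (- y)\<bar> \<ge> 1"
  proof (cases "y \<ge> 0")
    case True
    thus ?thesis using y exp_ge_add_one_self[of y] exp_le_one_iff[of "-y"] by linarith
  next
    case False
    thus ?thesis using y exp_ge_add_one_self[of "-y"] exp_le_one_iff[of y] by linarith
  qed
  hence 3: "norm (exp (pi * \<i> * x) - exp (- (pi * \<i> * x))) \<ge> 1"
    using norm_triangle_ineq3[of "exp (pi * \<i> * x)" "exp (- (pi * \<i> * x))"] unfolding n1 by linarith
  have "norm (R_integrand s x) = norm (x powr (- s)) * norm (exp (pi * \<i> * x\<^sup>2))
          / norm (exp (pi * \<i> * x) - exp (- (pi * \<i> * x)))"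
    by (simp only: R_integrand_def norm_mult norm_divide)
  also have "\<dots> \<le> norm (x powr (- s)) * norm (exp (pi * \<i> * x\<^sup>2)) / 1"
    using 3 by (intro divide_left_mono) auto
  also have "\<dots> \<le> exp (S * (\<bar>v\<bar> + 1 + pi)) * exp (2 * pi * \<bar>v\<bar> - pi * v\<^sup>2)"
    unfolding div_by_1 by (intro mult_mono 1 2) auto
  also have "\<dots> = exp (S * (1 + pi) + (B * \<bar>v\<bar> - pi * v\<^sup>2))"
    by (simp add: B_def algebra_simps flip: exp_add)
  also have "\<dots> \<le> exp (S * (1 + pi) + B\<^sup>2 + (- v\<^sup>2))"
  proof -
    have "2 * v\<^sup>2 \<le> pi * v\<^sup>2" using pi_gt3 by (intro mult_right_mono) auto
    moreover have "0 \<le> (B - \<bar>v\<bar>)\<^sup>2" "0 \<le> B\<^sup>2" "0 \<le> v\<^sup>2" by simp_all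
    moreover have "(B - \<bar>v\<bar>)\<^sup>2 = B\<^sup>2 + v\<^sup>2 - 2 * (B * \<bar>v\<bar>)" by (simp add: power2_diff)
    ultimately have "B * \<bar>v\<bar> - pi * v\<^sup>2 \<le> B\<^sup>2 - v\<^sup>2" by linarith
    thus ?thesis by simp
  qed
  also have "\<dots> = exp (norm s * (1 + pi) + (norm s + 2 * pi)\<^sup>2) * exp (- v\<^sup>2)"
    unfolding exp_add[symmetric] S_def B_def ..
  finally show "norm (R_integrand s (complex_of_real c + of_real v * R_dir))
     \<le> exp (norm s * (1 + pi) + (norm s + 2 * pi)\<^sup>2) * exp (- v\<^sup>2)" unfolding x_def .
qed

lemma R_line_integrable:
  assumes c: "0 < c" "c < 1" shows "integrable lborel (R_line_integrand c s)"
proof -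
  note cont = R_line_integrand_continuous[OF c, of s]
  obtain A where A: "\<And>c v. 0 \<le> c \<Longrightarrow> c \<le> 1 \<Longrightarrow> \<bar>v\<bar> \<ge> 1 \<Longrightarrow>
    norm (R_integrand s (complex_of_real c + of_real v * R_dir)) \<le> A * exp (- v\<^sup>2)"
    using R_integrand_bound by blast
  have "compact (R_line_integrand c s ` {-1..1})"
    by (intro compact_continuous_image continuous_on_subset[OF cont]) auto
  then obtain M where "\<forall>w \<in> R_line_integrand c s ` {-1..1}. norm w \<le> M"
    using compact_imp_bounded bounded_iff by blast
  hence M: "norm (R_line_integrand c s v) \<le> M" if "v \<in> {-1..1}" for v
    using that by blast
  have M0: "M \<ge> 0" using order.trans[OF norm_ge_zero M[of 0]] by simp
  have bnd: "norm (R_line_integrand c s v) \<le> max A (M * exp 1) * exp (- v\<^sup>2)" for v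
  proof (cases "\<bar>v\<bar> \<ge> 1")
    case True
    have "norm (R_line_integrand c s v) \<le> A * exp (- v\<^sup>2)"
      using A[of c v] True c by (simp add: R_line_integrand_def norm_mult R_dir_simps)
    also have "\<dots> \<le> max A (M * exp 1) * exp (- v\<^sup>2)" by (intro mult_right_mono) auto
    finally show ?thesis .
  next
    case False
    hence "v\<^sup>2 \<le> 1" by (simp add: abs_square_le_1)
    hence "exp 1 * exp (- v\<^sup>2) \<ge> 1" by (simp flip: exp_add)
    hence "M * 1 \<le> M * (exp 1 * exp (- v\<^sup>2))" using M0 by (intro mult_left_mono)
    also have "\<dots> \<le> max A (M * exp 1) * exp (- v\<^sup>2)"
      unfolding mult.assoc[symmetric] by (intro mult_right_mono) auto
    finally have "M \<le> max A (M * exp 1) * exp (- v\<^sup>2)" by simp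
    moreover have "v \<in> {-1..1}" using False by auto
    ultimately show ?thesis using M[of v] by linarith
  qed
  have "integrable lborel (\<lambda>v::real. exp (- v\<^sup>2))"
    using has_bochner_integral_even_function[OF gaussian_moment_0] by (auto simp: has_bochner_integral_iff)
  hence int: "integrable lborel (\<lambda>v. max A (M * exp 1) * exp (- v\<^sup>2))"
    by (rule integrable_mult_right)
  have "norm (R_line_integrand c s v) \<le> norm (max A (M * exp 1) * exp (- v\<^sup>2))" for v
    using order.trans[OF bnd[of v] abs_ge_self] by (simp only: real_norm_def)
  thus ?thesis
    using borel_measurable_continuous_onI[OF cont]
    by (intro Bochner_Integration.integrable_bound[OF int] AE_I2) auto
qed

lemma Riemann_R_eq:
  assumes c: "0 < c" "c < 1"
  shows "has_bochner_integral lborel (R_line_integrand c s) (Riemann_R s)"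
proof -
  obtain A where A: "\<And>c v. 0 \<le> c \<Longrightarrow> c \<le> 1 \<Longrightarrow> \<bar>v\<bar> \<ge> 1 \<Longrightarrow>
    norm (R_integrand s (complex_of_real c + of_real v * R_dir)) \<le> A * exp (- v\<^sup>2)"
    using R_integrand_bound by blast
  obtain G where G: "\<And>x. x \<in> R_strip \<Longrightarrow> (G has_field_derivative R_integrand s x) (at x within R_strip)"
    using holomorphic_convex_primitive'[OF convex_R_strip open_R_strip R_integrand_holomorphic] by metis
  have G': "(G has_field_derivative R_integrand s x) (at x)" if "x \<in> R_strip" for x
    using G[OF that] at_within_open[OF that open_R_strip] by simp
  define L where "L = (\<lambda>c u :: real. complex_of_real c + of_real u * R_dir)"
  define J where "J = (\<lambda>c n. G (L c (real n)) - G (L c (- real n)))"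
  have J: "J b \<longlonglongrightarrow> (LBINT u. R_line_integrand b s u)" if b: "0 < b" "b < 1" for b
  proof -
    have int: "(LBINT u. indicator {- real n..real n} u *\<^sub>R R_line_integrand b s u) = J b n" for n
      unfolding J_def
    proof (intro integral_FTC_atLeastAtMost)
      fix u :: real
      have "((G \<circ> (\<lambda>u. L b u)) has_vector_derivative (R_dir * R_integrand s (L b u))) (at u)"
        using R_line_in_strip[OF b, of u]
        by (intro field_vector_diff_chain_at G') (auto simp: L_def intro!: derivative_eq_intros)
      thus "((\<lambda>u. G (L b u)) has_vector_derivative R_line_integrand b s u) (at u within {- real n..real n})"
        by (simp add: o_def R_line_integrand_def L_def mult.commute has_vector_derivative_at_within)
    qed (auto intro: continuous_on_subset[OF R_line_integrand_continuous[OF b]])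
    have "(\<lambda>n. LBINT u. indicator {- real n..real n} u *\<^sub>R R_line_integrand b s u)
            \<longlonglongrightarrow> (LBINT u. R_line_integrand b s u)"
    proof (rule integral_dominated_convergence[where w = "\<lambda>u. norm (R_line_integrand b s u)"])
      show "AE u in lborel. (\<lambda>n. indicator {- real n..real n} u *\<^sub>R R_line_integrand b s u)
              \<longlonglongrightarrow> R_line_integrand b s u"
      proof (intro AE_I2 tendsto_eventually)
        fix u :: real
        show "\<forall>\<^sub>F n in sequentially. indicator {- real n..real n} u *\<^sub>R R_line_integrand b s u = R_line_integrand b s u"
          using eventually_ge_at_top[of "nat \<lceil>\<bar>u\<bar>\<rceil>"]
          by eventually_elim (auto simp: indicator_def nat_le_iff ceiling_le_iff abs_le_iff)
      qed
    qed (use R_line_integrable[OF b, of s] in \<open>auto simp: indicator_def\<close>)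
    thus ?thesis unfolding int .
  qed
  have near: "norm (G (L b v) - G (L c v)) \<le> A * exp (- v\<^sup>2) * norm (L b v - L c v)"
    if b: "0 < b" "b < 1" and v: "\<bar>v\<bar> \<ge> 1" for b v
  proof (rule field_differentiable_bound[where S = "closed_segment (L c v) (L b v)" and f' = "R_integrand s"])
    fix z assume "z \<in> closed_segment (L c v) (L b v)"
    then obtain t where t: "0 \<le> t" "t \<le> 1" "z = (1 - t) *\<^sub>R L c v + t *\<^sub>R L b v"
      by (auto simp: closed_segment_def)
    define d where "d = (1 - t) * c + t * b"
    have "d \<in> {0<..<1}" unfolding d_def
      using convexD[of "{0<..<1::real}" c b "1 - t" t] t b c by (auto simp: convex_real_interval)
    moreover have z: "z = L d v" unfolding t(3) d_def L_def by (simp add: scaleR_conv_of_real algebra_simps)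
    ultimately show "(G has_field_derivative R_integrand s z) (at z within closed_segment (L c v) (L b v))"
      using G'[of z] R_line_in_strip[of d v] by (auto simp: L_def has_field_derivative_at_within)
    show "norm (R_integrand s z) \<le> A * exp (- v\<^sup>2)"
      using A[of d v] v \<open>d \<in> _\<close> by (simp add: z L_def)
  qed auto
  have D: "norm (L b v - L c v) \<le> 1" if "0 < b" "b < 1" for b v
    using that c by (simp add: L_def abs_le_iff flip: of_real_diff)
  have "(\<lambda>n. J (1/2) n - J c n) \<longlonglongrightarrow> 0"
  proof (rule Lim_null_comparison)
    have A0: "A \<ge> 0" using order.trans[OF norm_ge_zero A[of 0 1]] by (simp add: zero_le_mult_iff)
    have *: "norm (G (L (1/2) v) - G (L c v)) \<le> A * exp (- v\<^sup>2)" if "\<bar>v\<bar> \<ge> 1" for v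
      using near[of "1/2" v] that mult_left_mono[OF D[of "1/2" v], of "A * exp (- v\<^sup>2)"] A0 by auto
    show "\<forall>\<^sub>F n in sequentially. norm (J (1/2) n - J c n) \<le> 2 * A * exp (- (real n)\<^sup>2)"
      using eventually_ge_at_top[of 1]
    proof eventually_elim
      case (elim n)
      have "J (1/2) n - J c n = (G (L (1/2) (real n)) - G (L c (real n))) -
             (G (L (1/2) (- real n)) - G (L c (- real n)))" by (simp add: J_def)
      also have "norm \<dots> \<le> A * exp (- (real n)\<^sup>2) + A * exp (- (- real n)\<^sup>2)"
        by (intro order.trans[OF norm_triangle_ineq4] add_mono *) (use elim in auto)
      finally show ?case by simp
    qed
    show "(\<lambda>n. 2 * A * exp (- (real n)\<^sup>2)) \<longlonglongrightarrow> 0" by real_asymp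
  qed
  moreover have "(\<lambda>n. J (1/2) n - J c n) \<longlonglongrightarrow> Riemann_R s - (LBINT u. R_line_integrand c s u)"
    unfolding Riemann_R_def by (intro tendsto_diff J c) auto
  ultimately have "Riemann_R s = (LBINT u. R_line_integrand c s u)"
    using LIMSEQ_unique by fastforce
  thus ?thesis using R_line_integrable[OF c] by (simp add: has_bochner_integral_iff)
qed


subsection \<open>Existence and uniqueness of phi\<close>

lemma norm_phi_weight:
  fixes \<xi> :: complex
  assumes "norm \<xi> = r" "Arg \<xi> = a" "r > 0"
  shows "norm (\<xi> powr (- 2 * pi * \<i> * \<xi>\<^sup>2) * exp (pi * \<i> * \<xi>\<^sup>2 + pi * \<xi>)) =
    exp (pi * r * (2 * r * (sin (2 * a) * ln r + a * cos (2 * a)) - r * sin (2 * a) + cos a))"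
proof -
  have nz: "\<xi> \<noteq> 0" using assms by auto
  have x: "\<xi> = r * cis a" using rcis_cmod_Arg[of \<xi>] assms by (simp add: rcis_def)
  have ln: "Ln \<xi> = ln r + \<i> * a" using nz assms by (simp add: Ln_Arg)
  have x2: "\<xi>\<^sup>2 = r^2 * cis (2 * a)"
    by (simp add: x power_mult_distrib power2_eq_square[of "cis a"] cis_mult flip: mult_2)
  have rex: "Re \<xi> = r * cos a" by (simp add: x)
  have re: "Re (\<xi>\<^sup>2) = r^2 * cos (2 * a)" "Im (\<xi>\<^sup>2) = r^2 * sin (2 * a)"
    unfolding x2 by (simp_all flip: of_real_power)
  have "Re (- 2 * pi * \<i> * \<xi>\<^sup>2 * Ln \<xi> + (pi * \<i> * \<xi>\<^sup>2 + pi * \<xi>)) =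
     2 * pi * (Im (\<xi>\<^sup>2) * ln r + Re (\<xi>\<^sup>2) * a) - pi * Im (\<xi>\<^sup>2) + pi * Re \<xi>"
    by (simp add: ln algebra_simps del: Re_power2 Im_power2)
  also have "\<dots> = pi * r * (2 * r * (sin (2 * a) * ln r + a * cos (2 * a)) - r * sin (2 * a) + cos a)"
    unfolding re rex by (simp add: algebra_simps power2_eq_square)
  finally show ?thesis using nz by (simp add: powr_def exp_add[symmetric] norm_exp_eq_Re del: Re_power2)
qed

lemma phi_slice_ex1:
  fixes r :: real
  assumes r: "r \<ge> exp 1"
  defines "W \<equiv> \<lambda>a. 2 * r * (sin (2 * a) * ln r + a * cos (2 * a)) - r * sin (2 * a) + cos a"
  shows "\<exists>b\<in>{0..pi/4}. \<forall>a\<in>{-(pi/2)..-(pi/4)}. W a \<le> 0 \<longleftrightarrow> - (pi / 2) + b \<le> a"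
proof -
  have r1: "r \<ge> 1" "ln r \<ge> 1" using r one_le_exp_iff[of "1::real"]
    by (linarith, smt (verit) exp_gt_zero ln_exp ln_le_cancel_iff)
  define W' where "W' = (\<lambda>a. 4 * r * cos (2 * a) * ln r - 4 * r * a * sin (2 * a) - sin a)"
  have d: "(W has_real_derivative W' a) (at a)" for a
    unfolding W_def W'_def by (auto intro!: derivative_eq_intros simp: algebra_simps)
  have neg: "W' a < 0" if a: "a \<in> {-(pi/2)..-(pi/4)}" for a
  proof -
    define t where "t = - (2 * a) - pi / 2"
    have t: "0 \<le> t" "t \<le> pi / 2" using a by (auto simp: t_def)
    have c: "cos (2 * a) = - sin t" 
      using cos_minus[of "2*a"] by (simp add: t_def sin_diff)
    have s: "sin (2 * a) = - cos t"
      using sin_minus[of "2*a"] by (simp add: t_def cos_diff)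
    have st: "sin t \<ge> 0" "cos t \<ge> 0" using t by (auto intro!: sin_ge_zero cos_ge_zero)
    have "(sin t + cos t)^2 = 1 + 2 * sin t * cos t"
      using sin_cos_squared_add[of t] by (simp add: power2_sum)
    hence "(sin t + cos t)^2 \<ge> 1^2" using st by simp
    hence sc: "sin t + cos t \<ge> 1" by (rule power2_le_imp_le) (use st in linarith)
    have "4 * r * sin t * ln r \<ge> 4 * r * sin t * (3/4)" using st r1 by (intro mult_left_mono) auto
    moreover have "4 * r * cos t * (-a) \<ge> 4 * r * cos t * (3/4)"
      using st r1 a pi_gt3 by (intro mult_left_mono) auto
    ultimately have "4 * r * sin t * ln r + 4 * r * cos t * (-a) \<ge> 3 * (r * (sin t + cos t))"
      by (simp add: algebra_simps)
    moreover have "r * (sin t + cos t) \<ge> 1 * 1" using sc r1 by (intro mult_mono) auto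
    moreover have "- sin a \<le> 1" using sin_ge_minus_one[of a] by linarith
    moreover have "W' a = - (4 * r * sin t * ln r + 4 * r * cos t * (-a)) - sin a"
      unfolding W'_def c s by (simp add: algebra_simps)
    ultimately show ?thesis by linarith
  qed
  have mono: "W b < W a" if "a < b" "a \<in> {-(pi/2)..-(pi/4)}" "b \<in> {-(pi/2)..-(pi/4)}" for a b
    using that d neg by (intro DERIV_neg_imp_decreasing[OF that(1)]) force
  have W0: "W (-(pi/2)) > 0" using r1 by (simp add: W_def)
  have "W (-(pi/4)) = r * (1 - 2 * ln r) + sqrt 2 / 2"
    by (simp add: W_def cos_45 algebra_simps)
  moreover have "r * (1 - 2 * ln r) \<le> r * (- 1)" using r1 by (intro mult_left_mono) auto
  moreover have "sqrt 2 / 2 \<le> 1" using sqrt2_less_2 by simp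
  ultimately have W1: "W (-(pi/4)) \<le> 0" using r1 by linarith
  have "\<exists>a0. -(pi/2) \<le> a0 \<and> a0 \<le> -(pi/4) \<and> W a0 = 0"
    using W0 W1 d by (intro IVT2) (auto intro: DERIV_isCont)
  then obtain a0 where a0: "-(pi/2) \<le> a0" "a0 \<le> -(pi/4)" "W a0 = 0" by auto
  have "W a \<le> 0 \<longleftrightarrow> a0 \<le> a" if "a \<in> {-(pi/2)..-(pi/4)}" for a
    using mono[of a a0] mono[of a0 a] a0 that by (cases a a0 rule: linorder_cases) auto
  thus ?thesis using a0 by (intro bexI[of _ "a0 + pi / 2"]) auto
qed

lemma phi_ex1: "\<exists>!f. f \<in> {exp 1..} \<rightarrow>\<^sub>E {0..pi / 4} \<and> phi_property f"
proof -
  define W where "W = (\<lambda>r a. 2 * r * (sin (2 * a) * ln r + a * cos (2 * a)) - r * sin (2 * a) + cos a :: real)"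
  have "\<forall>r\<in>{exp 1..}. \<exists>b. b\<in>{0..pi/4} \<and> (\<forall>a\<in>{-(pi/2)..-(pi/4)}. W r a \<le> 0 \<longleftrightarrow> - (pi / 2) + b \<le> a)"
    using phi_slice_ex1 unfolding W_def by (simp add: Bex_def)
  from bchoice[OF this] obtain g where g: "\<And>r. r \<ge> exp 1 \<Longrightarrow> g r \<in> {0..pi/4}"
     "\<And>r a. r \<ge> exp 1 \<Longrightarrow> a \<in> {-(pi/2)..-(pi/4)} \<Longrightarrow> W r a \<le> 0 \<longleftrightarrow> - (pi / 2) + g r \<le> a"
    by (metis atLeast_iff)
  have le1: "norm (\<xi> powr (- 2 * pi * \<i> * \<xi>\<^sup>2) * exp (pi * \<i> * \<xi>\<^sup>2 + pi * \<xi>)) \<le> 1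
      \<longleftrightarrow> - (pi / 2) + g (norm \<xi>) \<le> Arg \<xi>" 
    if "norm \<xi> \<ge> exp 1" "Arg \<xi> \<in> {-(pi/2)..-(pi/4)}" for \<xi> :: complex
  proof -
    have "norm \<xi> > 0" using that(1) exp_gt_zero[of "1::real"] by linarith
    thus ?thesis using g(2)[OF that] unfolding norm_phi_weight[OF refl refl \<open>norm \<xi> > 0\<close>]
      by (simp add: W_def mult_le_0_iff not_le[THEN iffD2, OF pi_gt_zero])
  qed
  define g' where "g' = restrict g {exp 1..}"
  show ?thesis
  proof (rule ex1I[of _ g'])
    have "phi_property g'"
      unfolding phi_property_def g'_def
    proof (intro Collect_cong)
      fix \<xi> :: complex
      show "(exp 1 \<le> cmod \<xi> \<and>
          cmod (\<xi> powr (- 2 * pi * \<i> * \<xi>\<^sup>2) * exp (pi * \<i> * \<xi>\<^sup>2 + pi * \<xi>)) \<le> 1 \<and>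
          - (pi / 2) \<le> Arg \<xi> \<and> Arg \<xi> \<le> - (pi / 4)) \<longleftrightarrow>
         (exp 1 \<le> cmod \<xi> \<and> - (pi / 2) + restrict g {exp 1..} (cmod \<xi>) \<le> Arg \<xi> \<and> Arg \<xi> \<le> - (pi / 4))"
      proof (cases "exp 1 \<le> cmod \<xi>")
        case True
        have "0 \<le> g (cmod \<xi>)" using g(1)[OF True] by simp
        with True le1[OF True] show ?thesis by auto
      qed auto
    qed
    thus "g' \<in> {exp 1..} \<rightarrow>\<^sub>E {0..pi / 4} \<and> phi_property g'"
      using g(1) by (auto simp: g'_def)
  next
    fix f assume f: "f \<in> {exp 1..} \<rightarrow>\<^sub>E {0..pi / 4} \<and> phi_property f"
    have "f r = g r" if r: "r \<ge> exp 1" for r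
    proof -
      have f': "f r \<in> {0..pi/4}" using f r by auto
      have r0: "r > 0" using r exp_gt_zero[of "1::real"] by linarith
      have key: "- (pi / 2) + g r \<le> a \<longleftrightarrow> - (pi / 2) + f r \<le> a" if a: "a \<in> {-(pi/2)..-(pi/4)}" for a
      proof -
        define \<xi> where "\<xi> = rcis r a"
        have n: "norm \<xi> = r" using r0 by (simp add: \<xi>_def)
        have A: "Arg \<xi> = a" using r0 a pi_gt3 unfolding \<xi>_def
          by (intro Arg_unique'[of r]) (auto simp: rcis_def cis_conv_exp mult_ac, linarith?)
        show ?thesis
          using conjunct2[OF f, unfolded phi_property_def set_eq_iff, rule_format, of \<xi>] le1[of \<xi>] r a
          unfolding mem_Collect_eq n A by simp
      qed
      show ?thesis using key[of "- (pi / 2) + g r"] key[of "- (pi / 2) + f r"] f' g(1)[OF r] by auto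
    qed
    thus "f = g'" using f by (auto simp: g'_def PiE_def extensional_def fun_eq_iff)
  qed
qed

lemma phi_unique_on:
  assumes "f \<in> {exp 1..} \<rightarrow> {0..pi / 4}" "phi_property f" "r \<ge> exp 1"
  shows "f r = phi r"
proof -
  let ?f = "restrict f {exp 1..}"
  have "phi_property ?f" using assms(2) unfolding phi_property_def
    by (auto intro!: Collect_cong simp: set_eq_iff restrict_def) 
  hence "phi = ?f" unfolding phi_def using assms
    by (intro the1_equality[OF phi_ex1]) (auto simp: restrict_PiE_iff)
  thus ?thesis using assms(3) by (metis atLeast_iff restrict_apply')
qed

lemma phi_works: "phi \<in> {exp 1..} \<rightarrow>\<^sub>E {0..pi / 4}" "phi_property phi"
  using theI'[OF phi_ex1] by (simp_all flip: phi_def)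

end

theory Submission
  imports Defs
begin

text \<open>
  Write \<open>s = 2 \<pi> \<i> \<xi>\<^sup>2\<close> with \<open>\<xi>\<close> in the fourth quadrant; \<open>\<xi>\<close> is the saddle point of
  \<open>x powr (- s) * exp (\<pi> \<i> x\<^sup>2)\<close>. Moving the line of integration to the half-integer line nearest
  to \<open>\<xi>\<close> picks up the residues \<open>n powr (- s)\<close> at the integers \<open>n \<le> l\<close>, and on the new line the
  integrand is at most a constant times a Gaussian times its value \<open>E\<close> at \<open>\<xi>\<close>. In the region \<open>E\<close>
  tends to 0: for \<open>Arg \<xi> \<le> - \<pi>/4\<close> the definition of \<open>phi\<close> gives \<open>E \<le> exp (- \<pi> Re \<xi>)\<close> and forces
  \<open>Re \<xi>\<close> to grow like \<open>r / ln r\<close>, where \<open>r = norm \<xi>\<close>; otherwise \<open>Re s \<ge> 2\<close> gives \<open>E \<le> e / r\<^sup>2\<close>.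
  Finally the sum of \<open>1 / n\<^sup>2\<close> over \<open>n \<ge> 2\<close> is at most \<open>25/36 < 3/4\<close>.
\<close>

section \<open>Descent of the exponent along lines of direction \<open>R_dir\<close>\<close>

lemma R_dir_sq: "R_dir * R_dir = \<i>"
proof -
  have "sqrt 2 * sqrt 2 = (2::real)" by simp
  thus ?thesis by (simp add: complex_eq_iff R_dir_simps)
qed

text \<open>The derivative \<open>2 * pi * \<i> * x - s / x\<close> equals
  \<open>2 * pi * \<i> * (x\<^sup>2 - \<xi>\<^sup>2) / x\<close>; the factored form shows the zero
  at \<open>\<xi>\<close> and leaves only the ratio \<open>\<xi> / x\<close> to be
  controlled.\<close>

lemma has_field_derivative_saddle_exponent:
  assumes x: "x \<notin> \<real>\<^sub>\<le>\<^sub>0" and s: "s = 2 * pi * \<i> * \<xi>\<^sup>2"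
  shows "((\<lambda>x. - s * Ln x + pi * \<i> * x\<^sup>2) has_field_derivative
           2 * pi * \<i> * (x - \<xi>) * (1 + \<xi> / x)) (at x within A)"
proof -
  have "x \<noteq> 0" using x by auto
  thus ?thesis using x unfolding s
    by (auto intro!: derivative_eq_intros simp: field_simps power2_eq_square)
qed

lemma norm_powr_times_exp:
  assumes "x \<noteq> 0"
  shows "norm (x powr (- s) * exp (pi * \<i> * x\<^sup>2)) = exp (Re (- s * Ln x + pi * \<i> * x\<^sup>2))"
  using assms by (simp add: powr_def norm_mult exp_add[symmetric] del: Re_power2 Im_power2)

lemma notin_nonpos_Reals_if_Re_gt_Im:
  assumes "Re x - Im x > 0" shows "x \<notin> \<real>\<^sub>\<le>\<^sub>0"
  using assms by (auto simp: complex_nonpos_Reals_iff)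

text \<open>\<open>R_dir\<close> is the direction of steepest descent at \<open>\<xi>\<close>: since
  \<open>R_dir * R_dir = \<i>\<close>, the derivative of the exponent in \<open>v\<close> is
  \<open>- (2 * pi * v) * (1 + \<xi> / X v)\<close>. As the real part of \<open>\<xi> / X v\<close>
  never falls below \<open>- 1 / 4\<close> in the fourth quadrant, three quarters of the ideal decay
  \<open>pi * v\<^sup>2\<close> survive for every \<open>v\<close>, not merely near the
  saddle.\<close>

lemma saddle_diagonal:
  assumes \<xi>: "Re \<xi> \<ge> 0" "Im \<xi> \<le> 0" "\<xi> \<noteq> 0" and s: "s = 2 * pi * \<i> * \<xi>\<^sup>2"
  defines "f \<equiv> \<lambda>x. - s * Ln x + pi * \<i> * x\<^sup>2"
  shows "Re (f (\<xi> + of_real v * R_dir)) \<le> Re (f \<xi>) - 3 / 4 * pi * v\<^sup>2"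
proof -
  define X where "X = (\<lambda>v::real. \<xi> + of_real v * R_dir)"
  \<comment> \<open>Once the claimed decay is added back, it remains to see that \<open>h\<close> is
    largest at \<open>v = 0\<close>, which follows from the sign of its derivative on either
    side.\<close>
  define h where "h = (\<lambda>v. Re (f (X v)) + 3 / 4 * pi * v\<^sup>2)"
  have pos: "Re (X v) - Im (X v) > 0" for v
    using \<xi> by (auto simp: X_def R_dir_simps complex_eq_iff)
  hence X0: "X v \<noteq> 0" for v by (metis diff_self less_irrefl zero_complex.sel)
  have fX: "((\<lambda>v. f (X v)) has_vector_derivative - (2 * pi * v) * (1 + \<xi> / X v)) (at v)" for v
  proof -
    have "((f \<circ> X) has_vector_derivative R_dir * (2 * pi * \<i> * (X v - \<xi>) * (1 + \<xi> / X v))) (at v)"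
      unfolding f_def X_def
      by (intro field_vector_diff_chain_at has_field_derivative_saddle_exponent s
            notin_nonpos_Reals_if_Re_gt_Im)
         (use pos[of v] in \<open>auto intro!: derivative_eq_intros simp: X_def\<close>)
    moreover have "R_dir * (2 * pi * \<i> * (X v - \<xi>) * (1 + \<xi> / X v)) =
        - (2 * pi * v) * (1 + \<xi> / X v)"
    proof -
      have "R_dir * (2 * pi * \<i> * (X v - \<xi>)) = 2 * pi * \<i> * v * (R_dir * R_dir)"
        by (simp add: X_def)
      also have "\<dots> = - (2 * pi * v)" unfolding R_dir_sq by simp
      finally show ?thesis by (simp only: mult.assoc[symmetric])
    qed
    ultimately show ?thesis by (simp only: o_def)
  qed
  have d: "(h has_real_derivative - (2 * pi * v) * (1 / 4 + Re (\<xi> / X v))) (at v)" for v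
  proof -
    have "((\<lambda>v. Re (f (X v))) has_real_derivative Re (- (2 * pi * v) * (1 + \<xi> / X v))) (at v)"
      using bounded_linear.has_vector_derivative[OF bounded_linear_Re fX[of v]]
      by (simp add: has_real_derivative_iff_has_vector_derivative)
    moreover have "((\<lambda>v. 3 / 4 * pi * v\<^sup>2) has_real_derivative 3 / 4 * pi * (2 * v)) (at v)"
      by (auto intro!: derivative_eq_intros)
    ultimately have "(h has_real_derivative Re (- (2 * pi * v) * (1 + \<xi> / X v)) + 3 / 4 * pi * (2 * v)) (at v)"
      unfolding h_def by (rule DERIV_add)
    moreover have "Re (- (2 * pi * v) * (1 + \<xi> / X v)) = - (2 * pi * v) * (1 + Re (\<xi> / X v))"
      by simp
    ultimately show ?thesis by (simp add: algebra_simps)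
  qed
  have re: "1 / 4 + Re (\<xi> / X v) \<ge> 0" for v
  proof -
    define a b k where "a = Re \<xi>" and "b = - Im \<xi>" and "k = v * (sqrt 2 / 2)"
    have ab: "a \<ge> 0" "b \<ge> 0" using \<xi> by (auto simp: a_def b_def)
    have X: "Re (X v) = a - k" "Im (X v) = - b - k"
      by (simp_all add: X_def a_def b_def k_def R_dir_simps)
    have "0 \<le> 4 * (a * (a - k) + b * (b + k)) + ((a - k)\<^sup>2 + (b + k)\<^sup>2)"
    proof -
      \<comment> \<open>Completing the square in \<open>k\<close>; the remaining cross term
        \<open>a * b\<close> is nonnegative because \<open>\<xi>\<close> lies in the closed fourth
        quadrant.\<close>
      have "2 * (4 * (a * (a - k) + b * (b + k)) + ((a - k)\<^sup>2 + (b + k)\<^sup>2))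
          = (2 * k - 3 * (a - b))\<^sup>2 + a\<^sup>2 + b\<^sup>2 + 18 * (a * b)"
        by (simp add: power2_eq_square algebra_simps)
      also have "\<dots> \<ge> 0" using ab by simp
      finally show ?thesis by simp
    qed
    moreover have "(a - k)\<^sup>2 + (b + k)\<^sup>2 > 0"
      using X0[of v] X by (simp add: complex_eq_iff sum_power2_gt_zero_iff) linarith
    moreover have "Re (\<xi> / X v) = (a * (a - k) + b * (b + k)) / ((a - k)\<^sup>2 + (b + k)\<^sup>2)"
      by (simp add: Re_divide X flip: a_def)
         (simp add: b_def power2_eq_square algebra_simps)
    moreover have "1 / 4 + p / q \<ge> 0" if "0 \<le> 4 * p + q" "q > 0" for p q :: real
      using that by (simp add: field_simps)
    ultimately show ?thesis by simp
  qed
  have "h v \<le> h 0"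
  proof (cases "v \<ge> 0")
    case True
    show ?thesis
      by (rule DERIV_nonpos_imp_nonincreasing[OF True]) (use d re in \<open>auto intro!: exI mult_nonneg_nonneg\<close>)
  next
    case False
    hence "v \<le> 0" by simp
    thus ?thesis
      by (rule DERIV_nonneg_imp_nondecreasing)
         (use d re in \<open>auto intro!: exI simp: mult_le_0_iff zero_le_mult_iff\<close>)
  qed
  thus ?thesis by (simp add: h_def X_def)
qed

text \<open>A horizontal displacement of at most 1/2 from the line through \<open>\<xi>\<close>
  changes the exponent by an amount that grows only linearly in \<open>\<bar>v\<bar>\<close>. The
  quadratic decay of \<open>saddle_diagonal\<close> absorbs it at the price of the constant
  \<open>8 * pi\<close>, uniformly in \<open>\<xi>\<close>.\<close>

lemma saddle_line:
  assumes \<xi>: "Re \<xi> \<ge> 0" "Im \<xi> \<le> 0" "norm \<xi> \<ge> 2" and s: "s = 2 * pi * \<i> * \<xi>\<^sup>2"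
    and \<delta>: "\<bar>\<delta>\<bar> \<le> 1 / 2" and x: "x = \<xi> + of_real v * R_dir + of_real \<delta>"
  shows "norm (x powr (- s) * exp (pi * \<i> * x\<^sup>2)) \<le>
           norm (\<xi> powr (- s) * exp (pi * \<i> * \<xi>\<^sup>2)) * exp (8 * pi - v\<^sup>2)"
proof -
  define f where "f = (\<lambda>x. - s * Ln x + pi * \<i> * x\<^sup>2)"
  define y where "y = \<xi> + of_real v * R_dir"
  have low: "norm \<xi> \<le> Re \<xi> - Im \<xi>" using cmod_le[of \<xi>] \<xi> by simp
  have seg: "norm (2 * pi * \<i> * (z - \<xi>) * (1 + \<xi> / z)) \<le> 6 * pi * (\<bar>v\<bar> + 1 / 2) \<and> z \<notin> \<real>\<^sub>\<le>\<^sub>0"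
    if z: "z \<in> closed_segment y x" for z
  proof -
    obtain t where t: "0 \<le> t" "t \<le> 1" "z = y + of_real (t * \<delta>)"
      using z unfolding closed_segment_def x y_def
      by (auto simp: scaleR_conv_of_real algebra_simps)
    have td: "\<bar>t * \<delta>\<bar> \<le> 1 / 2" using mult_mono[of "\<bar>t\<bar>" 1 "\<bar>\<delta>\<bar>" "1/2"] t \<delta> by (simp add: abs_mult)
    have rz: "Re z - Im z = Re \<xi> - Im \<xi> + t * \<delta>" by (simp add: t y_def R_dir_simps)
    \<comment> \<open>\<open>Re z - Im z\<close> is constant in direction \<open>R_dir\<close>, so
      only the displacement of at most 1/2 matters, and this is at most a quarter of
      \<open>norm \<xi>\<close>. The aim is \<open>norm z \<ge> norm \<xi> / 2\<close>, which bounds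
      \<open>1 + \<xi> / z\<close> by 3.\<close>
    hence rz2: "Re z - Im z \<ge> 3 / 4 * norm \<xi>" using td low \<xi> by linarith
    have "(Re z - Im z)\<^sup>2 \<le> 2 * (norm z)\<^sup>2"
    proof -
      have "2 * (norm z)\<^sup>2 = (Re z - Im z)\<^sup>2 + (Re z + Im z)\<^sup>2"
        unfolding cmod_power2 by (simp add: power2_eq_square algebra_simps)
      thus ?thesis by simp
    qed
    hence "2 * (norm z)\<^sup>2 \<ge> (3 / 4 * norm \<xi>)\<^sup>2" using power_mono[OF rz2, of 2] by simp
    hence "9 * (norm \<xi>)\<^sup>2 \<le> 32 * (norm z)\<^sup>2" by (simp add: power_mult_distrib power_divide)
    moreover have "p / 4 \<le> q" if "9 * p \<le> 32 * q" "0 \<le> q" for p q :: real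
      using that by linarith
    ultimately have "(norm \<xi>)\<^sup>2 / 4 \<le> (norm z)\<^sup>2" using zero_le_power2 by blast
    hence "(norm \<xi> / 2)\<^sup>2 \<le> (norm z)\<^sup>2" by (simp add: power_divide)
    hence nz: "norm z \<ge> norm \<xi> / 2" by (rule power2_le_imp_le) simp
    have "norm z > 0" using nz \<xi>(3) by linarith
    hence "norm (\<xi> / z) \<le> 2" using nz by (simp add: norm_divide field_simps)
    hence 1: "norm (1 + \<xi> / z) \<le> 3" using norm_triangle_ineq[of 1 "\<xi> / z"] by simp
    have "z - \<xi> = of_real v * R_dir + of_real (t * \<delta>)" by (simp add: t y_def)
    hence "norm (z - \<xi>) \<le> norm (of_real v * R_dir) + norm (complex_of_real (t * \<delta>))"
      by (simp only: norm_triangle_ineq)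
    hence 2: "norm (z - \<xi>) \<le> \<bar>v\<bar> + 1 / 2" using td by (simp add: norm_mult R_dir_simps)
    have "norm (2 * pi * \<i> * (z - \<xi>) * (1 + \<xi> / z)) = 2 * pi * (norm (z - \<xi>) * norm (1 + \<xi> / z))"
      by (simp add: norm_mult)
    also have "\<dots> \<le> 2 * pi * ((\<bar>v\<bar> + 1 / 2) * 3)"
      by (intro mult_left_mono mult_mono 1 2) auto
    finally show ?thesis using notin_nonpos_Reals_if_Re_gt_Im[of z] rz2 \<xi>(3) by (simp add: algebra_simps)
  qed
  have "norm (f x - f y) \<le> 6 * pi * (\<bar>v\<bar> + 1 / 2) * norm (x - y)"
    unfolding f_def
    by (rule field_differentiable_bound[OF convex_closed_segment[of y x]
          has_field_derivative_saddle_exponent[OF _ s]])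
       (use seg in auto)
  also have "\<dots> \<le> 6 * pi * (\<bar>v\<bar> + 1 / 2) * (1 / 2)"
    using \<delta> by (intro mult_left_mono) (auto simp: x y_def)
  finally have 1: "Re (f x) \<le> Re (f y) + 3 * pi * (\<bar>v\<bar> + 1 / 2)"
    using complex_Re_le_cmod[of "f x - f y"] by simp
  have 2: "Re (f y) \<le> Re (f \<xi>) - 3 / 4 * pi * v\<^sup>2"
    unfolding f_def y_def by (rule saddle_diagonal) (use \<xi> s in auto)
  \<comment> \<open>Half of the quadratic decay pays for the linear term. The other half, multiplied
    by \<open>pi\<close>, still exceeds \<open>v\<^sup>2\<close>.\<close>
  have "3 * (\<bar>v\<bar> + 1 / 2) - 3 / 4 * v\<^sup>2 \<le> 8 - 3 / 8 * v\<^sup>2"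
    using zero_le_power2[of "\<bar>v\<bar> - 4"] unfolding power2_diff by simp
  hence "pi * (3 * (\<bar>v\<bar> + 1 / 2) - 3 / 4 * v\<^sup>2) \<le> pi * (8 - 3 / 8 * v\<^sup>2)"
    by (intro mult_left_mono) auto
  moreover have "3 / 8 * pi * v\<^sup>2 \<ge> 1 * v\<^sup>2" using pi_gt3 by (intro mult_right_mono) auto
  ultimately have 3: "Re (f x) \<le> Re (f \<xi>) + (8 * pi - v\<^sup>2)"
    using 1 2 by (simp add: algebra_simps)
  have "x \<noteq> 0" "\<xi> \<noteq> 0" using seg[of x] \<xi>(3) by auto
  from this[THEN norm_powr_times_exp] show ?thesis
    using 3 by (simp only: f_def exp_add[symmetric] exp_le_cancel_iff)
qed

section \<open>The denominator on half-integer lines, decay and integrability\<close>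

text \<open>With \<open>z\<close> the argument of the sine, \<open>2 * Re z\<close> is an odd
  multiple of \<open>pi\<close> minus \<open>t\<close> and \<open>2 * Im z = - t\<close>, so the
  squared norm is \<open>(exp t + exp (- t) + 2 * cos t) / 4\<close>. For small \<open>t\<close> the
  cosine is positive, for large \<open>t\<close> the exponentials win; the bound depends on neither
  \<open>l\<close> nor \<open>u\<close>.\<close>

lemma norm_sin_half_integer_line:
  fixes l :: nat and u :: real
  shows "norm (sin (pi * (of_real (real l + 1 / 2) + of_real u * R_dir))) \<ge> 1 / 4"
proof -
  define t where "t = 2 * pi * (u * (sqrt 2 / 2))"
  define z where "z = pi * (complex_of_real (real l + 1 / 2) + of_real u * R_dir)"
  have im: "2 * Im z = - t" by (simp add: z_def t_def R_dir_simps)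
  have re: "2 * Re z = 2 * real l * pi + (pi - t)"
    by (simp add: z_def t_def R_dir_simps algebra_simps)
  have c: "cos (2 * Re z) = - cos t" unfolding re
    unfolding cos_add cos_2npi sin_2npi by (simp add: cos_diff)
  have "exp t + exp (- t) + 2 * cos t \<ge> 1 / 4"
  proof (cases "\<bar>t\<bar> \<le> 1")
    case True
    have "(sin (t / 2))\<^sup>2 \<le> (1 / 2)\<^sup>2"
      unfolding abs_le_square_iff[symmetric] using abs_sin_x_le_abs_x[of "t/2"] True by simp
    moreover have "cos t = 1 - 2 * (sin (t / 2))\<^sup>2" using cos_double_sin[of "t/2"] by simp
    ultimately have "cos t \<ge> 1 / 2" by (simp add: power2_eq_square)
    thus ?thesis using exp_gt_zero[of t] exp_gt_zero[of "-t"] by linarith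
  next
    case False
    have "exp t + exp (- t) = exp \<bar>t\<bar> + exp (- \<bar>t\<bar>)" by (auto simp: abs_if)
    moreover have "exp \<bar>t\<bar> \<ge> 1 + \<bar>t\<bar> + \<bar>t\<bar>\<^sup>2 / 2" by (rule exp_lower_Taylor_quadratic) simp
    moreover have "\<bar>t\<bar>\<^sup>2 \<ge> 1" using False by (simp only: one_le_power)
    ultimately have "exp t + exp (- t) \<ge> 5 / 2" using False exp_gt_zero[of "- \<bar>t\<bar>"] by linarith
    thus ?thesis using cos_ge_minus_one[of t] by linarith
  qed
  moreover have "(norm (sin z))\<^sup>2 = (exp t + exp (- t) + 2 * cos t) / 4"
    unfolding norm_sin_squared c im by (simp add: exp_minus)
  ultimately have "(norm (sin z))\<^sup>2 \<ge> (1 / 4)\<^sup>2" by (simp add: power2_eq_square)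
  thus ?thesis unfolding z_def by (rule power2_le_imp_le) simp
qed

lemma R_denom_eq_sin: "exp (pi * \<i> * x) - exp (- (pi * \<i> * x)) = 2 * \<i> * sin (pi * x)"
  for x :: complex
  unfolding sin_exp_eq by (simp add: field_simps)

lemma norm_R_denom_half_integer_line:
  "norm (exp (pi * \<i> * x) - exp (- (pi * \<i> * x))) \<ge> 1 / 2"
  if "x = complex_of_real (real l + 1 / 2) + of_real u * R_dir"
  using norm_sin_half_integer_line[of l u] unfolding R_denom_eq_sin that norm_mult by simp

text \<open>Extends the earlier bound from crossing points in [0, 1] to crossing points in [0, M],
  as needed to pass integers beyond 1. In direction \<open>R_dir\<close> the factor
  \<open>exp (pi * \<i> * x\<^sup>2)\<close> decays like \<open>exp (- pi * v\<^sup>2)\<close> up to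
  a factor exponential in \<open>\<bar>v\<bar>\<close>, and \<open>x powr (- s)\<close> grows at
  most exponentially in \<open>\<bar>v\<bar>\<close>.\<close>

lemma R_integrand_decay:
  assumes M: "M \<ge> 0"
  obtains A where "A \<ge> 0" "\<And>c v. 0 \<le> c \<Longrightarrow> c \<le> M \<Longrightarrow> \<bar>v\<bar> \<ge> 1 \<Longrightarrow>
    norm (R_integrand s (complex_of_real c + of_real v * R_dir)) \<le> A * exp (- v\<^sup>2)"
proof
  define B where "B = norm s + 2 * pi * M"
  define A where "A = exp (norm s * (M + 1 + pi) + B\<^sup>2)"
  show "A \<ge> 0" by (simp add: A_def)
  fix c v :: real
  assume c: "0 \<le> c" "c \<le> M" and v: "\<bar>v\<bar> \<ge> 1"
  define k :: real where "k = sqrt 2 / 2"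
  define x where "x = complex_of_real c + of_real v * R_dir"
  have kk: "2 * k * k = 1" by (simp add: k_def)
  have k: "k \<ge> 1 / 2" "k \<le> 1" using sqrt2_less_2 by (simp_all add: k_def)
  have x: "Re x = c - v * k" "Im x = - (v * k)" by (simp_all add: x_def R_dir_simps k_def)
  have "norm x \<le> norm (complex_of_real c) + norm (of_real v * R_dir)"
    unfolding x_def by (rule norm_triangle_ineq)
  hence xu: "norm x \<le> M + \<bar>v\<bar>" using c by (simp add: norm_mult R_dir_simps)
  have vk: "\<bar>v * k\<bar> \<ge> 1 / 2" using mult_mono[of 1 "\<bar>v\<bar>" "1/2" k] v k by (simp add: abs_mult)
  hence xl: "norm x \<ge> 1 / 2" using abs_Im_le_cmod[of x] x by simp
  hence x0: "x \<noteq> 0" by auto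
  have "- ln (norm x) = ln (1 / norm x)" using x0 by (simp add: ln_div)
  also have "\<dots> \<le> 1 / norm x - 1" using x0 by (intro ln_le_minus_one) auto
  also have "1 / norm x \<le> 2" using xl x0 by (simp add: field_simps)
  finally have "- ln (norm x) \<le> 1" by simp
  moreover have "ln (norm x) \<le> M + \<bar>v\<bar>" using ln_le_minus_one[of "norm x"] xu x0 by simp
  ultimately have "\<bar>ln (norm x)\<bar> \<le> \<bar>v\<bar> + M + 1" using M by linarith
  moreover have "\<bar>Im (Ln x)\<bar> \<le> pi" using mpi_less_Im_Ln[OF x0] Im_Ln_le_pi[OF x0] by linarith
  ultimately have "norm (Ln x) \<le> \<bar>v\<bar> + M + 1 + pi"
    using cmod_le[of "Ln x"] x0 by (simp add: Re_Ln)
  hence "norm s * norm (Ln x) \<le> norm s * (\<bar>v\<bar> + M + 1 + pi)" by (intro mult_left_mono) auto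
  moreover have "Re (- s * Ln x) \<le> norm s * norm (Ln x)"
    using complex_Re_le_cmod[of "- s * Ln x"] by (simp add: norm_mult)
  ultimately have 1: "norm (x powr (- s)) \<le> exp (norm s * (\<bar>v\<bar> + M + 1 + pi))"
    using x0 by (simp add: powr_def)
  have "v * (k * c) \<le> \<bar>v\<bar> * (k * c)" using c k by (intro mult_right_mono) auto
  moreover have "\<bar>v\<bar> * (k * c) \<le> \<bar>v\<bar> * (1 * M)" using c k by (intro mult_left_mono mult_mono) auto
  moreover have "Im (x\<^sup>2) = v\<^sup>2 * (2 * k * k) - 2 * (v * (k * c))"
    by (simp add: power2_eq_square x algebra_simps)
  ultimately have "Im (x\<^sup>2) \<ge> v\<^sup>2 - 2 * (\<bar>v\<bar> * M)" using kk by simp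
  hence "pi * (v\<^sup>2 - 2 * (\<bar>v\<bar> * M)) \<le> pi * Im (x\<^sup>2)" by (intro mult_left_mono) auto
  hence 2: "norm (exp (pi * \<i> * x\<^sup>2)) \<le> exp (2 * pi * M * \<bar>v\<bar> - pi * v\<^sup>2)"
    by (simp add: algebra_simps del: Im_power2)
  define y where "y = pi * (v * k)"
  have "pi * \<bar>v * k\<bar> \<ge> 2 * (1 / 2)" using vk pi_gt3 by (intro mult_mono) auto
  hence y: "\<bar>y\<bar> \<ge> 1" by (simp add: y_def abs_mult)
  have n1: "norm (exp (pi * \<i> * x)) = exp y" "norm (exp (- (pi * \<i> * x))) = exp (- y)"
    by (simp_all add: x y_def)
  \<comment> \<open>One of the two exponentials is at least 2 and the other at most 1.\<close>
  have "\<bar>exp y - exp (- y)\<bar> \<ge> 1"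
    using y exp_ge_add_one_self[of y] exp_le_one_iff[of "-y"]
      exp_ge_add_one_self[of "-y"] exp_le_one_iff[of y] by linarith
  hence 3: "norm (exp (pi * \<i> * x) - exp (- (pi * \<i> * x))) \<ge> 1"
    using norm_triangle_ineq3[of "exp (pi * \<i> * x)" "exp (- (pi * \<i> * x))"] unfolding n1 by linarith
  have "norm (R_integrand s x) = norm (x powr (- s)) * norm (exp (pi * \<i> * x\<^sup>2))
          / norm (exp (pi * \<i> * x) - exp (- (pi * \<i> * x)))"
    by (simp only: R_integrand_def norm_mult norm_divide)
  also have "\<dots> \<le> norm (x powr (- s)) * norm (exp (pi * \<i> * x\<^sup>2)) / 1"
    using 3 by (intro divide_left_mono) auto
  also have "\<dots> \<le> exp (norm s * (\<bar>v\<bar> + M + 1 + pi)) * exp (2 * pi * M * \<bar>v\<bar> - pi * v\<^sup>2)"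
    unfolding div_by_1 by (intro mult_mono 1 2) auto
  also have "\<dots> = exp (norm s * (M + 1 + pi) + (B * \<bar>v\<bar> - pi * v\<^sup>2))"
    by (simp add: B_def algebra_simps flip: exp_add)
  also have "\<dots> \<le> exp (norm s * (M + 1 + pi) + B\<^sup>2 + (- v\<^sup>2))"
  \<comment> \<open>Of \<open>pi * v\<^sup>2 \<ge> 2 * v\<^sup>2\<close>, one
    \<open>v\<^sup>2\<close> is spent on the linear term \<open>B * \<bar>v\<bar>\<close> and the
    other is kept.\<close>
  proof -
    have "2 * v\<^sup>2 \<le> pi * v\<^sup>2" using pi_gt3 by (intro mult_right_mono) auto
    moreover have "0 \<le> (B - \<bar>v\<bar>)\<^sup>2" "0 \<le> B\<^sup>2" "0 \<le> v\<^sup>2" by simp_all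
    moreover have "(B - \<bar>v\<bar>)\<^sup>2 = B\<^sup>2 + v\<^sup>2 - 2 * (B * \<bar>v\<bar>)" by (simp add: power2_diff)
    ultimately have "B * \<bar>v\<bar> - pi * v\<^sup>2 \<le> B\<^sup>2 - v\<^sup>2" by linarith
    thus ?thesis by simp
  qed
  also have "\<dots> = A * exp (- v\<^sup>2)" unfolding exp_add[symmetric] A_def ..
  finally show "norm (R_integrand s (complex_of_real c + of_real v * R_dir)) \<le> A * exp (- v\<^sup>2)"
    unfolding x_def .
qed

lemma has_bochner_integral_gaussian:
  "has_bochner_integral lborel (\<lambda>v. exp (- (v - a)\<^sup>2)) (sqrt pi)" for a :: real
proof -
  have "has_bochner_integral lborel (\<lambda>v::real. exp (- v\<^sup>2)) (sqrt pi)"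
    using has_bochner_integral_even_function[OF gaussian_moment_0] by simp
  thus ?thesis by (subst lborel_has_bochner_integral_real_affine_iff[where c=1 and t=a]) simp_all
qed

lemma R_line_integrand_continuous_half_integer:
  fixes l :: nat
  shows "continuous_on UNIV (R_line_integrand (real l + 1 / 2) s)"
proof -
  define x where "x = (\<lambda>u. complex_of_real (real l + 1 / 2) + of_real u * R_dir)"
  have "R_integrand s holomorphic_on range x"
    unfolding R_integrand_def
  proof (intro holomorphic_intros)
    fix z assume "z \<in> range x"
    then obtain u where z: "z = x u" by auto
    show "z \<notin> \<real>\<^sub>\<le>\<^sub>0" by (auto simp: z x_def complex_nonpos_Reals_iff R_dir_simps)
    show "exp (pi * \<i> * z) - exp (- (pi * \<i> * z)) \<noteq> 0"
      using norm_R_denom_half_integer_line[OF z[unfolded x_def]] by auto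
  qed
  hence "continuous_on UNIV (R_integrand s \<circ> x)"
    unfolding x_def by (intro continuous_on_compose continuous_intros holomorphic_on_imp_continuous_on)
  thus ?thesis unfolding R_line_integrand_def x_def by (intro continuous_intros) (simp add: o_def)
qed

lemma R_line_integrable_half_integer:
  fixes l :: nat
  shows "integrable lborel (R_line_integrand (real l + 1 / 2) s)"
proof -
  let ?F = "R_line_integrand (real l + 1 / 2) s"
  note cont = R_line_integrand_continuous_half_integer[of l s]
  obtain A where A: "A \<ge> 0" "\<And>c v. 0 \<le> c \<Longrightarrow> c \<le> real l + 1 / 2 \<Longrightarrow> \<bar>v\<bar> \<ge> 1 \<Longrightarrow>
    norm (R_integrand s (complex_of_real c + of_real v * R_dir)) \<le> A * exp (- v\<^sup>2)"
    using R_integrand_decay[of "real l + 1 / 2" s] by auto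
  have "compact (?F ` {-1..1})"
    by (intro compact_continuous_image continuous_on_subset[OF cont]) auto
  then obtain M where "\<forall>w \<in> ?F ` {-1..1}. norm w \<le> M"
    using compact_imp_bounded bounded_iff by blast
  hence M: "norm (?F v) \<le> M" if "\<bar>v\<bar> \<le> 1" for v
    using that by (auto simp: abs_le_iff)
  have M0: "M \<ge> 0" using order.trans[OF norm_ge_zero M[of 0]] by simp
  \<comment> \<open>The factor \<open>exp 1\<close> compensates \<open>exp (- v\<^sup>2)\<close> on
    the compact range, so a single Gaussian dominates on the whole line.\<close>
  have bnd: "norm (?F v) \<le> (A + M * exp 1) * exp (- v\<^sup>2)" for v
  proof (cases "\<bar>v\<bar> \<ge> 1")
    case True
    have "norm (?F v) \<le> A * exp (- v\<^sup>2)"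
      using A(2)[of "real l + 1 / 2" v] True by (simp add: R_line_integrand_def norm_mult R_dir_simps)
    thus ?thesis using M0 by (simp add: distrib_right add_increasing2)
  next
    case False
    hence "v\<^sup>2 \<le> 1" by (simp add: abs_square_le_1)
    hence "1 \<le> exp (1 + - v\<^sup>2)" by simp
    hence "M * 1 \<le> M * exp (1 + - v\<^sup>2)" using M0 by (intro mult_left_mono)
    hence "norm (?F v) \<le> M * exp (1 + - v\<^sup>2)" using M[of v] False by linarith
    thus ?thesis using A(1) unfolding exp_add by (simp add: distrib_right add_increasing mult.assoc)
  qed
  have int: "integrable lborel (\<lambda>v. (A + M * exp 1) * exp (- v\<^sup>2))"
    using has_bochner_integral_gaussian[of 0] by (auto simp: has_bochner_integral_iff)
  have "norm (?F v) \<le> norm ((A + M * exp 1) * exp (- v\<^sup>2))" for v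
    using order.trans[OF bnd[of v] abs_ge_self] by (simp only: real_norm_def)
  thus ?thesis
    using borel_measurable_continuous_onI[OF cont]
    by (intro Bochner_Integration.integrable_bound[OF int] AE_I2) auto
qed

section \<open>Moving the line of integration across an integer\<close>

text \<open>Turns a line integral into end values of a primitive, so that two lines can be compared
  through their far ends alone. The truncated integrals converge by dominated convergence with
  \<open>norm (f u)\<close> as majorant.\<close>

lemma LIMSEQ_FTC_LBINT:
  fixes f :: "real \<Rightarrow> complex"
  assumes F: "\<And>u. (F has_vector_derivative f u) (at u)"
    and cont: "continuous_on UNIV f" and int: "integrable lborel f"
  shows "(\<lambda>n. F (real n) - F (- real n)) \<longlonglongrightarrow> (LBINT u. f u)"
proof -
  have eq: "(LBINT u. indicator {- real n..real n} u *\<^sub>R f u) = F (real n) - F (- real n)" for n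
    by (intro integral_FTC_atLeastAtMost has_vector_derivative_at_within[OF F]
          continuous_on_subset[OF cont]) auto
  have "(\<lambda>n. LBINT u. indicator {- real n..real n} u *\<^sub>R f u) \<longlonglongrightarrow> (LBINT u. f u)"
  proof (rule integral_dominated_convergence[where w = "\<lambda>u. norm (f u)"])
    show "AE u in lborel. (\<lambda>n. indicator {- real n..real n} u *\<^sub>R f u) \<longlonglongrightarrow> f u"
    proof (intro AE_I2 tendsto_eventually)
      fix u :: real
      show "\<forall>\<^sub>F n in sequentially. indicator {- real n..real n} u *\<^sub>R f u = f u"
        using eventually_ge_at_top[of "nat \<lceil>\<bar>u\<bar>\<rceil>"]
        by eventually_elim (auto simp: indicator_def nat_le_iff ceiling_le_iff abs_le_iff)
    qed
  qed (use int in \<open>auto simp: indicator_def\<close>)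
  thus ?thesis unfolding eq .
qed

text \<open>Dividing both arguments by \<open>n\<close> cancels \<open>ln n\<close> in the
  difference, which leaves \<open>Ln (- R_dir) - Ln R_dir\<close>, with arguments
  \<open>pi / 4\<close> and \<open>- 3 * pi / 4\<close>. This is half of the full turn around a
  pole.\<close>

lemma LIMSEQ_Ln_R_dir:
  "(\<lambda>n. Ln (1 / 2 - of_nat n * R_dir) - Ln (1 / 2 + of_nat n * R_dir)) \<longlonglongrightarrow> \<i> * pi"
proof -
  define c where "c = (\<lambda>n. complex_of_real (1 / (2 * real n)))"
  have nr: "R_dir \<notin> \<real>\<^sub>\<le>\<^sub>0" "- R_dir \<notin> \<real>\<^sub>\<le>\<^sub>0"
    by (simp_all add: complex_nonpos_Reals_iff R_dir_simps)
  have "(\<lambda>n. 1 / (2 * real n)) \<longlonglongrightarrow> 0" by real_asymp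
  hence "c \<longlonglongrightarrow> 0" unfolding c_def by (metis of_real_0 tendsto_of_real)
  hence "(\<lambda>n. Ln (c n + - R_dir) - Ln (c n + R_dir)) \<longlonglongrightarrow> Ln (0 + - R_dir) - Ln (0 + R_dir)"
    using nr by (intro tendsto_intros) auto
  moreover have "Ln (0 + - R_dir) - Ln (0 + R_dir) = \<i> * pi"
  proof -
    have "R_dir \<noteq> 0" by (simp add: R_dir_def)
    thus ?thesis by (simp add: Ln_minus R_dir_simps)
  qed
  moreover have "\<forall>\<^sub>F n in sequentially. Ln (c n + - R_dir) - Ln (c n + R_dir) =
      Ln (1 / 2 - of_nat n * R_dir) - Ln (1 / 2 + of_nat n * R_dir)"
    using eventually_gt_at_top[of 0]
  proof eventually_elim
    case (elim n)
    have "Im (c n + - R_dir) \<noteq> 0" "Im (c n + R_dir) \<noteq> 0" by (simp_all add: c_def R_dir_simps)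
    hence nz: "c n + - R_dir \<noteq> 0" "c n + R_dir \<noteq> 0" by fastforce+
    have "1 / 2 - of_nat n * R_dir = of_real (real n) * (c n + - R_dir)"
      "1 / 2 + of_nat n * R_dir = of_real (real n) * (c n + R_dir)"
      using elim by (simp_all add: c_def field_simps)
    moreover have Ln: "Ln (of_real (real n) * z) = of_real (ln (real n)) + Ln z" if "z \<noteq> 0" for z
      using Ln_times_of_real[of "real n" z] elim that by (simp add: Ln_of_real)
    ultimately show ?case by (simp only: Ln[OF nz(1)] Ln[OF nz(2)] add_diff_cancel_left)
  qed
  ultimately show ?thesis by (simp only: Lim_transform_eventually)
qed

lemma exp_pi_i_of_nat: "exp (pi * \<i> * of_nat m) = (- 1) ^ m"
  using exp_of_nat_mult[of m "pi * \<i>"] by (simp add: mult_ac)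

text \<open>The residue theorem for the simple pole at \<open>a = l + 1\<close>, done with
  primitives. In a strip around \<open>a\<close> that contains both lines the integrand is a
  holomorphic \<open>H\<close> plus \<open>\<kappa> / (x - a)\<close>. The end values of a primitive
  of \<open>H\<close> cancel in the limit, and the logarithms of the polar part contribute
  \<open>2 * pi * \<i> * \<kappa>\<close>.\<close>

lemma R_line_shift:
  fixes l :: nat
  shows "(LBINT u. R_line_integrand (real l + 1 / 2) s u) =
    of_nat (Suc l) powr (- s) + (LBINT u. R_line_integrand (real (Suc l) + 1 / 2) s u)"
proof -
  define a where "a = complex_of_nat (Suc l)"
  define T where "T = {x. real l < Re x - Im x \<and> Re x - Im x < real l + 2}"
  define N where "N = (\<lambda>x. x powr (- s) * exp (pi * \<i> * x\<^sup>2))"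
  define D where "D = (\<lambda>x. exp (pi * \<i> * x) - exp (- (pi * \<i> * x)))"
  have "T = {x. inner (Complex 1 (-1)) x > real l} \<inter> {x. inner (Complex 1 (-1)) x < real l + 2}"
    by (auto simp: T_def inner_complex_def)
  hence convT: "convex T" and openT: "open T"
    by (auto intro!: convex_Int open_Int convex_halfspace_gt convex_halfspace_lt open_halfspace_gt open_halfspace_lt)
  have aT: "a \<in> T" by (simp add: a_def T_def)
  have NT: "x \<notin> \<real>\<^sub>\<le>\<^sub>0" if "x \<in> T" for x
    using that by (auto simp: T_def complex_nonpos_Reals_iff)
  have D0: "x = a" if x: "x \<in> T" "D x = 0" for x
  proof -
    have "sin (pi * x) = 0" using x(2) by (simp add: D_def R_denom_eq_sin)
    then obtain m :: int where "pi * x = of_real (m * pi)" unfolding sin_eq_0 by auto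
    hence m: "x = of_int m" by simp
    hence "m = int (Suc l)" using x(1) by (auto simp: T_def)
    thus ?thesis by (simp add: m a_def)
  qed
  have ea: "exp (pi * \<i> * a) = (-1) ^ Suc l" "exp (- (pi * \<i> * a)) = (-1) ^ Suc l"
    "exp (pi * \<i> * a\<^sup>2) = (-1) ^ Suc l"
  proof -
    show 1: "exp (pi * \<i> * a) = (-1) ^ Suc l" unfolding a_def by (rule exp_pi_i_of_nat)
    show "exp (- (pi * \<i> * a)) = (-1) ^ Suc l" unfolding exp_minus 1 by (cases "even l") auto
    have "exp (pi * \<i> * a\<^sup>2) = (-1) ^ ((Suc l)\<^sup>2)"
      unfolding a_def of_nat_power[symmetric] by (rule exp_pi_i_of_nat)
    thus "exp (pi * \<i> * a\<^sup>2) = (-1) ^ Suc l" by (cases "even l") (simp_all add: power2_eq_square)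
  qed
  have Da: "D a = 0" by (simp add: D_def ea)
  have "(D has_field_derivative pi * \<i> * exp (pi * \<i> * a) + pi * \<i> * exp (- (pi * \<i> * a))) (at a)"
    unfolding D_def by (auto intro!: derivative_eq_intros simp: algebra_simps)
  hence dD: "deriv D a = 2 * pi * \<i> * (-1) ^ Suc l" unfolding ea by (simp add: DERIV_imp_deriv)
  \<comment> \<open>The denominator with its simple zero at \<open>a\<close> divided out, filled in
    at \<open>a\<close> by the derivative. It is holomorphic and free of zeros in the strip.\<close>
  define q where "q = (\<lambda>x. if x = a then deriv D a else (D x - D a) / (x - a))"
  have hol_q: "q holomorphic_on T" unfolding q_def
    by (intro pole_lemma_open openT) (auto simp: D_def intro!: holomorphic_intros)
  have q0: "q x \<noteq> 0" if "x \<in> T" for x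
  proof (cases "x = a")
    case True
    thus ?thesis by (simp add: q_def dD)
  next
    case False
    hence "D x \<noteq> 0" using D0[OF that] by blast
    thus ?thesis using False by (simp add: q_def Da)
  qed
  have qD: "D x = q x * (x - a)" for x by (cases "x = a") (simp_all add: q_def Da)
  define P where "P = (\<lambda>x. N x / q x)"
  have hol_P: "P holomorphic_on T" unfolding P_def N_def
    by (intro holomorphic_intros hol_q q0 NT)
  define \<kappa> where "\<kappa> = P a"
  \<comment> \<open>The sign \<open>(-1) ^ Suc l\<close> of
    \<open>exp (pi * \<i> * a\<^sup>2)\<close> cancels that of \<open>deriv D a\<close>, because
    \<open>a\<^sup>2\<close> and \<open>a\<close> have the same parity.\<close>
  have \<kappa>: "\<kappa> * (2 * (\<i> * pi)) = of_nat (Suc l) powr (- s)"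
  proof -
    have "q a = 2 * pi * \<i> * (-1) ^ Suc l" by (simp add: q_def dD)
    thus ?thesis unfolding \<kappa>_def P_def N_def ea by (simp add: a_def)
  qed
  \<comment> \<open>The same removal of a singularity, now for the polar part of the
    integrand.\<close>
  define H where "H = (\<lambda>x. if x = a then deriv P a else (P x - P a) / (x - a))"
  have hol_H: "H holomorphic_on T" unfolding H_def by (intro pole_lemma_open openT hol_P)
  have split: "R_integrand s x = H x + \<kappa> / (x - a)" if "x \<in> T" "x \<noteq> a" for x
  proof -
    have "R_integrand s x = N x / D x" by (simp add: R_integrand_def N_def D_def)
    also have "\<dots> = P x / (x - a)" by (simp add: qD P_def)
    finally show ?thesis using that by (simp add: H_def \<kappa>_def diff_divide_distrib)
  qed
  obtain G where G_within: "\<And>x. x \<in> T \<Longrightarrow> (G has_field_derivative H x) (at x within T)"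
    using holomorphic_convex_primitive'[OF convT openT hol_H] by metis
  hence G: "(G has_field_derivative H x) (at x)" if "x \<in> T" for x
    using G_within[OF that] at_within_open[OF that openT] by simp
  define L where "L = (\<lambda>b u. complex_of_real b + of_real u * R_dir)"
  have LT: "L b u \<in> T" if "real l < b" "b < real l + 2" for b u
    using that by (simp add: L_def T_def R_dir_simps)
  define b1 b2 where "b1 = real l + 1 / 2" and "b2 = real (Suc l) + 1 / 2"
  \<comment> \<open>On the line \<open>b1\<close>, \<open>x - a\<close> meets the cut of
    \<open>Ln\<close> at \<open>u = 0\<close>, whereas \<open>a - x\<close> avoids it. Hence
    \<open>Ln (a - x)\<close> serves as primitive of \<open>1 / (x - a)\<close> on
    \<open>b1\<close>, and \<open>Ln (x - a)\<close> on \<open>b2\<close>.\<close>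
  have La: "L b1 u - a = - (1 / 2 - of_real u * R_dir)" "L b2 u - a = 1 / 2 + of_real u * R_dir" for u
    by (simp_all add: L_def b1_def b2_def a_def field_simps)
  have nonpos: "1 / 2 - of_real u * R_dir \<notin> \<real>\<^sub>\<le>\<^sub>0" "1 / 2 + of_real u * R_dir \<notin> \<real>\<^sub>\<le>\<^sub>0" for u
    by (auto simp: complex_nonpos_Reals_iff R_dir_simps)
  have ne_a: "L b1 u \<noteq> a" "L b2 u \<noteq> a" for u
    using nonpos[of u] La[of u] by (metis diff_self minus_zero nonpos_Reals_zero_I neg_equal_iff_equal)+
  define \<Phi>1 where "\<Phi>1 = (\<lambda>u. G (L b1 u) + \<kappa> * Ln (1 / 2 - of_real u * R_dir))"
  define \<Phi>2 where "\<Phi>2 = (\<lambda>u. G (L b2 u) + \<kappa> * Ln (1 / 2 + of_real u * R_dir))"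
  have GL: "((\<lambda>u. G (L b u)) has_vector_derivative R_dir * H (L b u)) (at u)"
    if "real l < b" "b < real l + 2" for b u
  proof -
    have "((G \<circ> (\<lambda>u. L b u)) has_vector_derivative (R_dir * H (L b u))) (at u)"
      by (intro field_vector_diff_chain_at G LT that)
         (auto simp: L_def intro!: derivative_eq_intros)
    thus ?thesis by (simp add: o_def)
  qed
  have LnL: "((\<lambda>u. Ln (1 / 2 + of_real u * w)) has_vector_derivative w * (1 / (1 / 2 + of_real u * w))) (at u)"
    if "1 / 2 + of_real u * w \<notin> \<real>\<^sub>\<le>\<^sub>0" for w u
  proof -
    have "((Ln \<circ> (\<lambda>u. 1 / 2 + of_real u * w)) has_vector_derivative w * inverse (1 / 2 + of_real u * w)) (at u)"
      by (intro field_vector_diff_chain_at has_field_derivative_Ln that)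
         (auto intro!: derivative_eq_intros)
    thus ?thesis by (simp add: o_def inverse_eq_divide)
  qed
  have d1: "(\<Phi>1 has_vector_derivative R_line_integrand b1 s u) (at u)" for u
  proof -
    have T: "L b1 u \<in> T" by (rule LT) (auto simp: b1_def)
    have "((\<lambda>u. G (L b1 u) + \<kappa> * Ln (1 / 2 + of_real u * (- R_dir))) has_vector_derivative
            R_dir * H (L b1 u) + \<kappa> * (- R_dir * (1 / (1 / 2 + of_real u * (- R_dir))))) (at u)"
      by (intro has_vector_derivative_add has_vector_derivative_mult_right GL LnL)
         (use nonpos(1)[of u] in \<open>auto simp: b1_def\<close>)
    moreover have "R_dir * H (L b1 u) + \<kappa> * (- R_dir * (1 / (1 / 2 + of_real u * (- R_dir))))
        = (H (L b1 u) + \<kappa> / (L b1 u - a)) * R_dir"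
    proof -
      have eq: "1 / 2 + of_real u * (- R_dir) = - (L b1 u - a)" by (simp add: La)
      have "\<kappa> * (- R_dir * (1 / - z)) = \<kappa> / z * R_dir" for z by simp
      thus ?thesis unfolding eq distrib_right by (simp only: mult.commute)
    qed
    ultimately show ?thesis using split[OF T ne_a(1)]
      by (simp add: \<Phi>1_def R_line_integrand_def L_def)
  qed
  have d2: "(\<Phi>2 has_vector_derivative R_line_integrand b2 s u) (at u)" for u
  proof -
    have T: "L b2 u \<in> T" by (rule LT) (auto simp: b2_def)
    have "((\<lambda>u. G (L b2 u) + \<kappa> * Ln (1 / 2 + of_real u * R_dir)) has_vector_derivative
            R_dir * H (L b2 u) + \<kappa> * (R_dir * (1 / (1 / 2 + of_real u * R_dir)))) (at u)"
      by (intro has_vector_derivative_add has_vector_derivative_mult_right GL LnL)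
         (use nonpos(2)[of u] in \<open>auto simp: b2_def\<close>)
    moreover have "R_dir * H (L b2 u) + \<kappa> * (R_dir * (1 / (1 / 2 + of_real u * R_dir)))
        = (H (L b2 u) + \<kappa> / (L b2 u - a)) * R_dir"
      unfolding La by (simp add: algebra_simps)
    ultimately show ?thesis using split[OF T ne_a(2)]
      by (simp add: \<Phi>2_def R_line_integrand_def L_def)
  qed
  have lim1: "(\<lambda>n. \<Phi>1 (real n) - \<Phi>1 (- real n)) \<longlonglongrightarrow> (LBINT u. R_line_integrand b1 s u)"
    using d1 unfolding b1_def
    by (intro LIMSEQ_FTC_LBINT R_line_integrand_continuous_half_integer R_line_integrable_half_integer)
  have lim2: "(\<lambda>n. \<Phi>2 (real n) - \<Phi>2 (- real n)) \<longlonglongrightarrow> (LBINT u. R_line_integrand b2 s u)"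
    using d2 unfolding b2_def
    by (intro LIMSEQ_FTC_LBINT R_line_integrand_continuous_half_integer R_line_integrable_half_integer)
  obtain A where A: "A \<ge> 0" "\<And>c v. 0 \<le> c \<Longrightarrow> c \<le> real l + 2 \<Longrightarrow> \<bar>v\<bar> \<ge> 1 \<Longrightarrow>
    norm (R_integrand s (complex_of_real c + of_real v * R_dir)) \<le> A * exp (- v\<^sup>2)"
    using R_integrand_decay[of "real l + 2" s] by auto
  \<comment> \<open>\<open>H\<close> is the integrand minus its polar part, so its bound contains a
    term of order \<open>1 / \<bar>v\<bar>\<close>. On a connecting segment of length 1 this
    suffices to make the ends agree in the limit.\<close>
  have near: "norm (G (L b1 v) - G (L b2 v)) \<le> A * exp (- v\<^sup>2) + 2 * norm \<kappa> / \<bar>v\<bar>"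
    if v: "\<bar>v\<bar> \<ge> 1" for v
  proof -
    have seg: "\<exists>d. z = L d v \<and> b1 \<le> d \<and> d \<le> b2"
      if z: "z \<in> closed_segment (L b2 v) (L b1 v)" for z
    proof -
      obtain t where t: "0 \<le> t" "t \<le> 1" "z = (1 - t) *\<^sub>R L b2 v + t *\<^sub>R L b1 v"
        using z by (auto simp: closed_segment_def)
      have "z = L (b2 - t) v" unfolding t(3) L_def b1_def b2_def
        by (simp add: scaleR_conv_of_real field_simps)
      thus ?thesis using t by (intro exI[of _ "b2 - t"]) (auto simp: b1_def b2_def)
    qed
    have "norm (G (L b1 v) - G (L b2 v)) \<le> (A * exp (- v\<^sup>2) + 2 * norm \<kappa> / \<bar>v\<bar>) * norm (L b1 v - L b2 v)"
    proof (rule field_differentiable_bound[where S = "closed_segment (L b2 v) (L b1 v)" and f' = H])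
      fix z assume "z \<in> closed_segment (L b2 v) (L b1 v)"
      from seg[OF this] obtain d where d: "z = L d v" "b1 \<le> d" "d \<le> b2" by blast
      have zT: "z \<in> T" unfolding d(1) by (rule LT) (use d in \<open>auto simp: b1_def b2_def\<close>)
      show "(G has_field_derivative H z) (at z within closed_segment (L b2 v) (L b1 v))"
        by (rule has_field_derivative_at_within[OF G[OF zT]])
      have "Im (z - a) = - (v * (sqrt 2 / 2))" by (simp add: d L_def a_def R_dir_simps)
      hence "\<bar>v\<bar> * (sqrt 2 / 2) \<le> norm (z - a)" using abs_Im_le_cmod[of "z - a"] by (simp add: abs_mult)
      moreover have "\<bar>v\<bar> * (1 / 2) \<le> \<bar>v\<bar> * (sqrt 2 / 2)" by (intro mult_left_mono) auto
      ultimately have za: "\<bar>v\<bar> / 2 \<le> norm (z - a)" by simp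
      hence na: "z \<noteq> a" using v by auto
      have "norm (\<kappa> / (z - a)) = norm \<kappa> / norm (z - a)" by (rule norm_divide)
      also have "\<dots> \<le> norm \<kappa> / (\<bar>v\<bar> / 2)" using za v by (intro divide_left_mono mult_pos_pos) auto
      finally have 1: "norm (\<kappa> / (z - a)) \<le> 2 * norm \<kappa> / \<bar>v\<bar>" by (simp add: mult.commute)
      have 2: "norm (R_integrand s z) \<le> A * exp (- v\<^sup>2)"
        unfolding d(1) L_def by (rule A(2)) (use d v in \<open>auto simp: b1_def b2_def\<close>)
      have "norm (H z) = norm (R_integrand s z - \<kappa> / (z - a))" using split[OF zT na] by simp
      thus "norm (H z) \<le> A * exp (- v\<^sup>2) + 2 * norm \<kappa> / \<bar>v\<bar>"
        using norm_triangle_ineq4[of "R_integrand s z" "\<kappa> / (z - a)"] 1 2 by linarith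
    qed auto
    moreover have "L b1 v - L b2 v = - 1" by (simp add: L_def b1_def b2_def)
    ultimately show ?thesis by simp
  qed
  define E where "E = (\<lambda>n::nat. (G (L b1 (real n)) - G (L b2 (real n)))
     - (G (L b1 (- real n)) - G (L b2 (- real n))))"
  have E0: "E \<longlonglongrightarrow> 0"
  proof (rule Lim_null_comparison)
    show "\<forall>\<^sub>F n in sequentially. norm (E n) \<le> 2 * (A * exp (- (real n)\<^sup>2) + 2 * norm \<kappa> / real n)"
      using eventually_ge_at_top[of 1]
    proof eventually_elim
      case (elim n)
      show ?case unfolding E_def
        using norm_triangle_ineq4[of "G (L b1 (real n)) - G (L b2 (real n))"
            "G (L b1 (- real n)) - G (L b2 (- real n))"] near[of "real n"] near[of "- real n"] elim
        by simp
    qed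
    show "(\<lambda>n. 2 * (A * exp (- (real n)\<^sup>2) + 2 * norm \<kappa> / real n)) \<longlonglongrightarrow> 0" by real_asymp
  qed
  \<comment> \<open>Passing from \<open>n\<close> to \<open>- n\<close> exchanges the two
    logarithms, so the half turn of \<open>LIMSEQ_Ln_R_dir\<close> is counted twice.\<close>
  have diff: "(\<Phi>1 (real n) - \<Phi>1 (- real n)) - (\<Phi>2 (real n) - \<Phi>2 (- real n)) =
     E n + \<kappa> * (2 * (Ln (1 / 2 - of_nat n * R_dir) - Ln (1 / 2 + of_nat n * R_dir)))" for n
    by (simp add: \<Phi>1_def \<Phi>2_def E_def algebra_simps)
  have "(\<lambda>n. (\<Phi>1 (real n) - \<Phi>1 (- real n)) - (\<Phi>2 (real n) - \<Phi>2 (- real n)))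
      \<longlonglongrightarrow> 0 + \<kappa> * (2 * (\<i> * pi))"
    unfolding diff by (intro tendsto_intros E0 LIMSEQ_Ln_R_dir)
  hence "0 + \<kappa> * (2 * (\<i> * pi)) =
      (LBINT u. R_line_integrand b1 s u) - (LBINT u. R_line_integrand b2 s u)"
    using tendsto_diff[OF lim1 lim2] LIMSEQ_unique by blast
  thus ?thesis unfolding \<kappa> b1_def b2_def by (simp add: algebra_simps)
qed

lemma Riemann_R_eq_sum_plus_line:
  "Riemann_R s = (\<Sum>n=1..l. of_nat n powr (- s)) + (LBINT u. R_line_integrand (real l + 1 / 2) s u)"
proof (induction l)
  \<comment> \<open>For \<open>l = 0\<close> the sum is empty and the line is the one in the
    definition of \<open>Riemann_R\<close>.\<close>
  case 0
  show ?case by (simp add: Riemann_R_def)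
next
  case (Suc l)
  thus ?case using R_line_shift[of l s] by (simp add: add.assoc)
qed

text \<open>Moving to the half-integer line nearest to the saddle leaves an integral dominated by a
  Gaussian times the saddle value. The factor 2 comes from the denominator and
  \<open>sqrt pi\<close> from the Gaussian integral.\<close>

lemma Riemann_R_near_partial_sum:
  assumes \<xi>: "Re \<xi> \<ge> 0" "Im \<xi> \<le> 0" "norm \<xi> \<ge> 2" and s: "s = 2 * pi * \<i> * \<xi>\<^sup>2"
  obtains l :: nat where "l \<ge> 1"
    "norm (Riemann_R s - (\<Sum>n=1..l. of_nat n powr (- s))) \<le>
       norm (\<xi> powr (- s) * exp (pi * \<i> * \<xi>\<^sup>2)) * (2 * exp (8 * pi) * sqrt pi)"
proof -
  define E where "E = norm (\<xi> powr (- s) * exp (pi * \<i> * \<xi>\<^sup>2))"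
  \<comment> \<open>The line of direction \<open>R_dir\<close> through \<open>\<xi>\<close> crosses
    the real axis at \<open>c\<close> and reaches \<open>\<xi>\<close> at parameter
    \<open>v0\<close>. Rounding \<open>c\<close> down and adding 1/2 moves it by
    \<open>\<delta>\<close>.\<close>
  define c where "c = Re \<xi> - Im \<xi>"
  define l where "l = nat \<lfloor>c\<rfloor>"
  define \<delta> where "\<delta> = real l + 1 / 2 - c"
  define v0 where "v0 = - (Im \<xi> * sqrt 2)"
  have c: "c \<ge> 2" using cmod_le[of \<xi>] \<xi> by (simp add: c_def)
  hence l: "real l \<le> c" "c < real l + 1" "l \<ge> 1" unfolding l_def by linarith+
  have \<delta>: "\<bar>\<delta>\<bar> \<le> 1 / 2" using l unfolding \<delta>_def by linarith
  let ?F = "R_line_integrand (real l + 1 / 2) s"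
  have bnd: "norm (?F u) \<le> E * (2 * exp (8 * pi)) * exp (- (u - v0)\<^sup>2)" for u
  proof -
    define x where "x = complex_of_real (real l + 1 / 2) + of_real u * R_dir"
    have s2: "sqrt 2 * sqrt 2 = (2::real)" by simp
    have "x = \<xi> + of_real (u - v0) * R_dir + of_real \<delta>"
      using s2 by (simp add: x_def complex_eq_iff R_dir_simps \<delta>_def c_def v0_def algebra_simps)
    from saddle_line[OF \<xi> s \<delta> this]
    have 1: "norm (x powr (- s) * exp (pi * \<i> * x\<^sup>2)) \<le> E * exp (8 * pi - (u - v0)\<^sup>2)"
      unfolding E_def .
    have 2: "norm (exp (pi * \<i> * x) - exp (- (pi * \<i> * x))) \<ge> 1 / 2"
      by (rule norm_R_denom_half_integer_line[OF x_def])
    have "norm (?F u) = norm (x powr (- s) * exp (pi * \<i> * x\<^sup>2))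
        / norm (exp (pi * \<i> * x) - exp (- (pi * \<i> * x)))"
      by (simp only: R_line_integrand_def R_integrand_def norm_mult norm_divide x_def R_dir_simps mult_1_right)
    also have "\<dots> \<le> E * exp (8 * pi - (u - v0)\<^sup>2) / (1 / 2)"
      by (intro frac_le 1 2) (auto simp: E_def)
    also have "\<dots> = E * (2 * exp (8 * pi)) * exp (- (u - v0)\<^sup>2)"
      using exp_add[of "8 * pi" "- (u - v0)\<^sup>2"] by simp
    finally show ?thesis .
  qed
  note gauss = has_bochner_integral_mult_right[OF has_bochner_integral_gaussian[of v0],
      of "E * (2 * exp (8 * pi))"]
  have "norm (LBINT u. ?F u) \<le> (LBINT u. norm (?F u))"
    by (rule integral_norm_bound)
  also have "\<dots> \<le> (LBINT u. E * (2 * exp (8 * pi)) * exp (- (u - v0)\<^sup>2))"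
    using gauss bnd R_line_integrable_half_integer[of l s]
    by (intro integral_mono) (auto simp: has_bochner_integral_iff)
  also have "\<dots> = E * (2 * exp (8 * pi)) * sqrt pi"
    using gauss by (simp add: has_bochner_integral_iff)
  finally have "norm (LBINT u. ?F u) \<le> E * (2 * exp (8 * pi) * sqrt pi)" by (simp add: mult.assoc)
  moreover have "Riemann_R s - (\<Sum>n=1..l. of_nat n powr (- s)) = (LBINT u. ?F u)"
    using Riemann_R_eq_sum_plus_line[of s l] by simp
  ultimately show ?thesis using that[OF l(3)] unfolding E_def by simp
qed

section \<open>The partial sums of the Dirichlet series\<close>

text \<open>The terms 1/4 and 1/9 are kept exactly, and those from \<open>n = 4\<close> on telescope
  to less than 1/3 by comparison with \<open>1 / (n - 1) - 1 / n\<close>. The total 25/36 leaves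
  1/18 below 3/4.\<close>

lemma sum_inverse_squares_from_2_le: "(\<Sum>n=2..l. 1 / (real n)\<^sup>2) \<le> 25 / 36"
proof -
  have "(\<Sum>n=2..k+3. 1 / (real n)\<^sup>2) \<le> 25 / 36 - 1 / (real k + 3)" for k :: nat
  proof (induction k)
    case 0
    have "{2..3} = {2, 3::nat}" by auto
    thus ?case by (simp add: power2_eq_square)
  next
    case (Suc k)
    have "1 / (real k + 4)\<^sup>2 \<le> 1 / ((real k + 3) * (real k + 4))"
      by (intro divide_left_mono) (auto simp: power2_eq_square)
    also have "\<dots> = 1 / (real k + 3) - 1 / (real k + 4)" by (simp add: field_simps)
    finally have "1 / (real k + 4)\<^sup>2 \<le> 1 / (real k + 3) - 1 / (real k + 4)" .
    moreover have "(\<Sum>n=2..Suc k + 3. 1 / (real n)\<^sup>2) =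
        (\<Sum>n=2..k+3. 1 / (real n)\<^sup>2) + 1 / (real k + 4)\<^sup>2"
      using sum.nat_ivl_Suc'[of 2 "k + 3" "\<lambda>n. 1 / (real n)\<^sup>2"] by (simp add: add_ac)
    ultimately show ?case using Suc by (simp add: add_ac)
  qed
  note * = this[of l]
  have "(\<Sum>n=2..l. 1 / (real n)\<^sup>2) \<le> (\<Sum>n=2..l+3. 1 / (real n)\<^sup>2)"
    by (intro sum_mono2) auto
  also have "\<dots> \<le> 25 / 36" using * by (rule order.trans) simp
  finally show ?thesis .
qed

lemma norm_Dirichlet_sum_minus_1_le:
  assumes s: "Re s \<ge> 2" and l: "l \<ge> 1"
  shows "norm ((\<Sum>n=1..l. of_nat n powr (- s)) - 1) \<le> 25 / 36"
proof -
  have "(\<Sum>n=1..l. of_nat n powr (- s)) = 1 + (\<Sum>n=2..l. of_nat n powr (- s))"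
    using sum.atLeast_Suc_atMost[OF l, of "\<lambda>n. of_nat n powr (- s)"] by (simp add: numeral_2_eq_2)
  hence "norm ((\<Sum>n=1..l. of_nat n powr (- s)) - 1) = norm (\<Sum>n=2..l. of_nat n powr (- s))"
    by simp
  also have "\<dots> \<le> (\<Sum>n=2..l. 1 / (real n)\<^sup>2)"
  proof (rule sum_norm_le)
    fix n assume n: "n \<in> {2..l}"
    have "norm (of_nat n powr (- s)) = real n powr (- Re s)"
      using n norm_powr_real_powr[of "of_nat n" "- s"] by simp
    also have "\<dots> \<le> real n powr (- 2)" using n s by (intro powr_mono) auto
    also have "\<dots> = 1 / (real n)\<^sup>2" using n by (simp add: powr_minus_divide)
    finally show "norm (of_nat n powr (- s)) \<le> 1 / (real n)\<^sup>2" .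
  qed
  also have "\<dots> \<le> 25 / 36" by (rule sum_inverse_squares_from_2_le)
  finally show ?thesis .
qed

section \<open>The size of the saddle value in \<open>region_L\<close>\<close>

text \<open>Here \<open>phi\<close> enters: its defining inequality is exactly a bound of the saddle
  value by \<open>exp (- pi * Re \<xi>)\<close>. The two terms of the maximum come from two possible
  lower bounds for \<open>cos \<theta>\<close>.\<close>

lemma saddle_term_le_low_arg:
  assumes r: "r \<ge> exp 1" and \<theta>: "- (pi / 2) + phi r \<le> \<theta>" "\<theta> \<le> - (pi / 4)"
    and \<xi>: "\<xi> = rcis r \<theta>" and s: "s = 2 * pi * \<i> * \<xi>\<^sup>2"
  shows "norm (\<xi> powr (- s) * exp (pi * \<i> * \<xi>\<^sup>2)) \<le> max (exp (- pi * (r / 2))) (exp (- pi * (pi * r / (16 * ln r))))"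
proof -
  have r0: "r > 0" using r exp_gt_zero[of "1::real"] by linarith
  have lr: "ln r \<ge> 1" using r r0 by (simp add: ln_ge_iff)
  have phi0: "phi r \<ge> 0" using phi_works(1) r by auto
  have n: "norm \<xi> = r" using r0 by (simp add: \<xi>)
  have A: "Arg \<xi> = \<theta>" using r0 \<theta> phi0 pi_gt3 unfolding \<xi>
    by (intro Arg_unique'[of r]) (auto simp: rcis_def cis_conv_exp mult_ac)
  have le1: "norm (\<xi> powr (- 2 * pi * \<i> * \<xi>\<^sup>2) * exp (pi * \<i> * \<xi>\<^sup>2 + pi * \<xi>)) \<le> 1"
    using phi_works(2)[unfolded phi_property_def set_eq_iff, rule_format, of \<xi>] r \<theta>
    unfolding mem_Collect_eq n A by simp
  define k where "k = cos \<theta>"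
  define E where "E = norm (\<xi> powr (- s) * exp (pi * \<i> * \<xi>\<^sup>2))"
  have "E * exp (pi * (r * k)) \<le> 1"
    using le1 by (simp add: E_def s exp_add norm_mult \<xi> k_def mult.assoc)
  hence E: "E \<le> exp (- pi * (r * k))" by (simp add: exp_minus field_simps)
  have k0: "k \<ge> 0" unfolding k_def using \<theta> phi0 by (intro cos_ge_zero) auto
  \<comment> \<open>If both failed, \<open>\<theta> * cos (2 * \<theta>)\<close> would be at least
    \<open>pi / 8\<close>, while \<open>sin (2 * \<theta>) * ln r\<close> would exceed
    \<open>- (pi / 8)\<close>. The exponent in \<open>norm_phi_weight\<close> would then be
    positive, against the inequality for \<open>phi\<close>.\<close>
  have "k \<ge> 1 / 2 \<or> k \<ge> pi / (16 * ln r)"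
  proof (rule ccontr)
    assume "\<not> ?thesis"
    hence k: "k < 1 / 2" "k * ln r < pi / 16" using lr by (auto simp: field_simps)
    have W: "2 * r * (sin (2 * \<theta>) * ln r + \<theta> * cos (2 * \<theta>)) - r * sin (2 * \<theta>) + cos \<theta> \<le> 0"
      using le1 unfolding norm_phi_weight[OF n A r0] using r0
      by (simp add: mult_le_0_iff not_le[THEN iffD2, OF pi_gt_zero])
    have s2: "sin (2 * \<theta>) = 2 * sin \<theta> * k" by (simp add: k_def sin_double)
    have c2: "cos (2 * \<theta>) = 2 * k\<^sup>2 - 1" by (simp add: k_def cos_double_cos)
    have "sin (- \<theta>) \<ge> 0" using \<theta> phi0 pi_gt3 by (intro sin_ge_zero) auto
    hence sn: "sin \<theta> \<le> 0" "sin \<theta> \<ge> - 1" by auto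
    have s2': "sin (2 * \<theta>) \<le> 0" "sin (2 * \<theta>) \<ge> - (2 * k)"
      unfolding s2 using sn k0 mult_right_mono[of "-1" "sin \<theta>" k] by (auto simp: mult_nonpos_nonneg mult_nonneg_nonpos mult.commute)
    have "k\<^sup>2 \<le> (1 / 2)\<^sup>2" using k k0 by (intro power_mono) auto
    hence "cos (2 * \<theta>) \<le> - (1 / 2)" unfolding c2 by (simp add: power2_eq_square)
    moreover have "\<theta> \<le> 0" using \<theta>(2) pi_gt_zero by linarith
    ultimately have "(pi / 4) * (1 / 2) \<le> (- \<theta>) * (- cos (2 * \<theta>))" using \<theta> by (intro mult_mono) auto
    moreover have "- (2 * k) * ln r \<le> sin (2 * \<theta>) * ln r" using s2' lr by (intro mult_right_mono) auto
    ultimately have "sin (2 * \<theta>) * ln r + \<theta> * cos (2 * \<theta>) > 0" using k(2) by simp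
    hence "2 * r * (sin (2 * \<theta>) * ln r + \<theta> * cos (2 * \<theta>)) > 0" using r0 by simp
    moreover have "r * sin (2 * \<theta>) \<le> 0" using r0 s2' by (simp add: mult_nonneg_nonpos)
    ultimately show False using W k0 unfolding k_def by linarith
  qed
  thus ?thesis
  proof
    assume "k \<ge> 1 / 2"
    hence "pi * (r * (1 / 2)) \<le> pi * (r * k)" using r0 by (intro mult_left_mono) auto
    hence "exp (- pi * (r * k)) \<le> exp (- pi * (r / 2))" by simp
    thus ?thesis using E unfolding E_def by linarith
  next
    assume "k \<ge> pi / (16 * ln r)"
    hence "pi * (r * (pi / (16 * ln r))) \<le> pi * (r * k)" using r0 by (intro mult_left_mono) auto
    hence "exp (- pi * (r * k)) \<le> exp (- pi * (pi * r / (16 * ln r)))" by (simp add: mult_ac)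
    thus ?thesis using E unfolding E_def by linarith
  qed
qed

text \<open>For these arguments \<open>Im s \<ge> 0\<close>. The exponent has real part
  \<open>Re s * (1 / 2 - ln r) + Im s * \<theta>\<close>, whose second term is not positive and
  whose first is largest at \<open>Re s = 2\<close>.\<close>

lemma saddle_term_le_high_arg:
  assumes r: "r \<ge> exp 1" and \<theta>: "- (pi / 4) \<le> \<theta>" "\<theta> \<le> 0"
    and \<xi>: "\<xi> = rcis r \<theta>" and s: "s = 2 * pi * \<i> * \<xi>\<^sup>2" and Re_s: "Re s \<ge> 2"
  shows "norm (\<xi> powr (- s) * exp (pi * \<i> * \<xi>\<^sup>2)) \<le> exp (1 - 2 * ln r)"
proof -
  have r0: "r > 0" using r exp_gt_zero[of "1::real"] by linarith
  have lr: "ln r \<ge> 1" using r r0 by (simp add: ln_ge_iff)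
  have nz: "\<xi> \<noteq> 0" using r0 by (simp add: \<xi>)
  have n: "norm \<xi> = r" using r0 by (simp add: \<xi>)
  have A: "Arg \<xi> = \<theta>" using r0 \<theta> pi_gt3 unfolding \<xi>
    by (intro Arg_unique'[of r]) (auto simp: rcis_def cis_conv_exp mult_ac)
  have Ln: "Ln \<xi> = ln r + \<i> * \<theta>" using nz by (simp add: Ln_Arg n A)
  have "(cis \<theta>)\<^sup>2 = cis (2 * \<theta>)" by (simp add: power2_eq_square cis_mult)
  hence "s = rcis (2 * pi * r\<^sup>2) (pi / 2 + 2 * \<theta>)"
    unfolding s \<xi> by (simp add: rcis_def power_mult_distrib cis_mult[symmetric])
  hence "Im s = 2 * pi * r\<^sup>2 * cos (2 * \<theta>)" by (simp add: sin_add)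
  moreover have "cos (2 * \<theta>) \<ge> 0" using \<theta> by (intro cos_ge_zero) auto
  ultimately have "Im s \<ge> 0" by simp
  hence "Im s * \<theta> \<le> 0" using \<theta> by (simp add: mult_nonneg_nonpos)
  moreover have "pi * \<i> * \<xi>\<^sup>2 = s / 2" by (simp add: s)
  hence "Re (- s * Ln \<xi> + pi * \<i> * \<xi>\<^sup>2) = Re s * (1 / 2 - ln r) + Im s * \<theta>"
    by (simp only: Ln) (simp add: algebra_simps)
  moreover have "Re s * (1 / 2 - ln r) \<le> 2 * (1 / 2 - ln r)"
    using Re_s lr by (intro mult_right_mono_neg) auto
  ultimately show ?thesis unfolding norm_powr_times_exp[OF nz] by simp
qed

lemma saddle_term_small:
  assumes \<epsilon>: "\<epsilon> > 0"
  obtains R where "R > 0" "\<And>s. s \<in> region_L \<Longrightarrow> Re s \<ge> 2 \<Longrightarrow> norm s \<ge> R \<Longrightarrow>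
    \<exists>\<xi>. Re \<xi> \<ge> 0 \<and> Im \<xi> \<le> 0 \<and> norm \<xi> \<ge> 2 \<and> s = 2 * pi * \<i> * \<xi>\<^sup>2 \<and>
      norm (\<xi> powr (- s) * exp (pi * \<i> * \<xi>\<^sup>2)) \<le> \<epsilon>"
proof -
  have lims: "((\<lambda>r. exp (- pi * (r / 2))) \<longlongrightarrow> 0) at_top"
    "((\<lambda>r. exp (- pi * (pi * r / (16 * ln r)))) \<longlongrightarrow> 0) at_top"
    "((\<lambda>r::real. exp (1 - 2 * ln r)) \<longlongrightarrow> 0) at_top"
    by real_asymp+
  have "\<forall>\<^sub>F r in at_top. exp (- pi * (r / 2)) < \<epsilon> \<and> exp (- pi * (pi * r / (16 * ln r))) < \<epsilon>
     \<and> exp (1 - 2 * ln r) < \<epsilon> \<and> r \<ge> 2"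
    using lims[THEN order_tendstoD(2), OF \<epsilon>] by (intro eventually_conj eventually_ge_at_top)
  then obtain r1 where r1: "\<And>r. r \<ge> r1 \<Longrightarrow> exp (- pi * (r / 2)) < \<epsilon> \<and>
      exp (- pi * (pi * r / (16 * ln r))) < \<epsilon> \<and> exp (1 - 2 * ln r) < \<epsilon> \<and> r \<ge> 2"
    unfolding eventually_at_top_linorder by blast
  show ?thesis
  proof (rule that)
    have "r1\<^sup>2 > 0" using r1[OF order.refl] by simp
    \<comment> \<open>The threshold for \<open>norm s\<close> is the one that makes the modulus of
      \<open>\<xi>\<close> at least \<open>r1\<close>.\<close>
    thus "2 * pi * r1\<^sup>2 > 0" by simp
    fix s assume sL: "s \<in> region_L" and s2: "Re s \<ge> 2" and ns: "norm s \<ge> 2 * pi * r1\<^sup>2"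
    define r where "r = sqrt (norm s / (2 * pi))"
    \<comment> \<open>Of the two square roots of \<open>s / (2 * pi * \<i>)\<close> this selects the
      one in the fourth quadrant; the bounds on \<open>Arg s\<close> in \<open>region_L\<close>
      become \<open>- (pi / 2) + phi r < \<theta> < 0\<close>.\<close>
    define \<theta> where "\<theta> = (Arg s - pi / 2) / 2"
    define \<xi> where "\<xi> = rcis r \<theta>"
    have rr: "r\<^sup>2 = norm s / (2 * pi)" by (simp add: r_def)
    have "norm s / (2 * pi) \<ge> (exp 1)\<^sup>2" using sL by (simp add: region_L_def field_simps)
    hence re: "r \<ge> exp 1" unfolding r_def by (rule real_le_rsqrt)
    have "norm s / (2 * pi) \<ge> r1\<^sup>2" using ns by (simp add: field_simps)
    hence "r \<ge> r1" unfolding r_def by (rule real_le_rsqrt)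
    note small = r1[OF this]
    have phi0: "phi r \<ge> 0" using phi_works(1) re by auto
    have \<theta>: "- (pi / 2) + phi r \<le> \<theta>" "\<theta> \<le> 0"
      using sL[unfolded region_L_def mem_Collect_eq, folded r_def] by (auto simp: \<theta>_def)
    have "(cis \<theta>)\<^sup>2 = cis (2 * \<theta>)" by (simp add: power2_eq_square cis_mult)
    hence "\<xi>\<^sup>2 = rcis (norm s / (2 * pi)) (2 * \<theta>)"
      by (simp add: \<xi>_def rcis_def power_mult_distrib flip: rr)
    then have "2 * pi * \<i> * \<xi>\<^sup>2 = rcis (norm s) (pi / 2 + 2 * \<theta>)"
      by (simp add: rcis_def cis_mult[symmetric])
    moreover have "pi / 2 + 2 * \<theta> = Arg s" by (simp add: \<theta>_def field_simps)
    ultimately have s: "s = 2 * pi * \<i> * \<xi>\<^sup>2" by (simp only: rcis_cmod_Arg)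
    have "cos \<theta> \<ge> 0" "sin (- \<theta>) \<ge> 0" using \<theta> phi0 pi_gt3
      by (intro cos_ge_zero sin_ge_zero; linarith)+
    hence "Re \<xi> \<ge> 0" "Im \<xi> \<le> 0" using small by (simp_all add: \<xi>_def mult_nonneg_nonpos)
    moreover have "norm \<xi> \<ge> 2" using small by (simp add: \<xi>_def)
    moreover have "norm (\<xi> powr (- s) * exp (pi * \<i> * \<xi>\<^sup>2)) \<le> \<epsilon>"
    proof (cases "\<theta> \<le> - (pi / 4)")
      case True
      show ?thesis using saddle_term_le_low_arg[OF re \<theta>(1) True \<xi>_def s] small by linarith
    next
      case False
      hence "- (pi / 4) \<le> \<theta>" by simp
      from saddle_term_le_high_arg[OF re this \<theta>(2) \<xi>_def s s2] show ?thesis using small by linarith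
    qed
    ultimately show "\<exists>\<xi>. Re \<xi> \<ge> 0 \<and> Im \<xi> \<le> 0 \<and> norm \<xi> \<ge> 2 \<and> s = 2 * pi * \<i> * \<xi>\<^sup>2 \<and>
      norm (\<xi> powr (- s) * exp (pi * \<i> * \<xi>\<^sup>2)) \<le> \<epsilon>" using s by blast
  qed
qed

theorem corollary14:
  shows "\<exists>r0::real. r0 > 0 \<and>
    (\<forall>s \<in> region_L. Re s \<ge> 2 \<and> norm s \<ge> r0 \<longrightarrow>
       norm (Riemann_R s - 1) \<le> 3 / 4 \<and> Riemann_R s \<noteq> 0)"
proof -
  define K where "K = 2 * exp (8 * pi) * sqrt pi"
  have K: "K > 0" by (simp add: K_def)
  \<comment> \<open>With the saddle value below \<open>1 / (18 * K)\<close> the remainder is at most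
    1/18, and 1/18 + 25/36 = 3/4.\<close>
  hence "1 / (18 * K) > 0" by simp
  then obtain R where R: "R > 0" "\<And>s. s \<in> region_L \<Longrightarrow> Re s \<ge> 2 \<Longrightarrow> norm s \<ge> R \<Longrightarrow>
    \<exists>\<xi>. Re \<xi> \<ge> 0 \<and> Im \<xi> \<le> 0 \<and> norm \<xi> \<ge> 2 \<and> s = 2 * pi * \<i> * \<xi>\<^sup>2 \<and>
      norm (\<xi> powr (- s) * exp (pi * \<i> * \<xi>\<^sup>2)) \<le> 1 / (18 * K)"
    using saddle_term_small by blast
  have "norm (Riemann_R s - 1) \<le> 3 / 4" if sL: "s \<in> region_L" and s2: "Re s \<ge> 2" and sR: "norm s \<ge> R" for s
  proof -
    obtain \<xi> where \<xi>: "Re \<xi> \<ge> 0" "Im \<xi> \<le> 0" "norm \<xi> \<ge> 2" "s = 2 * pi * \<i> * \<xi>\<^sup>2"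
      "norm (\<xi> powr (- s) * exp (pi * \<i> * \<xi>\<^sup>2)) \<le> 1 / (18 * K)"
      using R(2)[OF sL s2 sR] by blast
    obtain l where l: "l \<ge> 1" "norm (Riemann_R s - (\<Sum>n=1..l. of_nat n powr (- s))) \<le>
       norm (\<xi> powr (- s) * exp (pi * \<i> * \<xi>\<^sup>2)) * K"
      using Riemann_R_near_partial_sum[OF \<xi>(1-4)] unfolding K_def by blast
    have "norm (\<xi> powr (- s) * exp (pi * \<i> * \<xi>\<^sup>2)) * K \<le> 1 / (18 * K) * K"
      using \<xi>(5) K by (intro mult_right_mono) auto
    also have "\<dots> = 1 / 18" using K by simp
    finally have 1: "norm (Riemann_R s - (\<Sum>n=1..l. of_nat n powr (- s))) \<le> 1 / 18"
      using l(2) by linarith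
    have "Riemann_R s - 1 = (Riemann_R s - (\<Sum>n=1..l. of_nat n powr (- s)))
        + ((\<Sum>n=1..l. of_nat n powr (- s)) - 1)" by simp
    also have "norm \<dots> \<le> 1 / 18 + 25 / 36"
      by (intro norm_triangle_mono 1 norm_Dirichlet_sum_minus_1_le s2 l(1))
    finally show ?thesis by simp
  qed
  moreover have "Riemann_R s \<noteq> 0" if "norm (Riemann_R s - 1) \<le> 3 / 4" for s
    using that by auto
  ultimately show ?thesis using R(1) by blast
qed

end
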